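(* Let $\mathcal{I}_{\mathrm{ST}}\subset\mathcal{A}_z^0$ be the set of standard relations. For every $w\in\mathcal{I}_{\mathrm{ST}}$, one has $L(w)=0$ (as a function of $z\in\mathbb{C}\setminus[0,1]$).
   Context: Let $\mathcal{A}_z=\mathbb{Z}\langle e_0,e_1,e_z\rangle$ be the free non-commutative (associative, unital) ring on formal symbols $e_0,e_1,e_z$, and $\mathcal{A}=\mathbb{Z}\langle e_0,e_1\rangle\subset\mathcal{A}_z$. Put $\mathcal{A}_z^0=\mathbb{Z}\oplus\mathbb{Z}e_z\oplus\bigoplus_{a\in\{1,z\},\,b\in\{0,z\}}e_a\mathcal{A}_ze_b$. For $z\in\mathbb{C}\setminus[0,1]$, $L:\mathcal{A}_z^0\to\mathbb{C}$ is the $\mathbb{Z}$-linear map with $L(e_{a_1}\cdots e_{a_m})=\int_{0<t_1<\cdots<t_m<1}\prod_{i=1}^m\frac{dt_i}{t_i-a_i}$ for words in $\mathcal{A}_z^0$ (with $L(1)=1$), where the label $a_i=z$ is interpreted as the complex number $z$. For fixed $w$, $L(w)$ is regarded as a holomorphic function of $z$ on $\mathbb{C}\setminus[0,1]$. For $\alpha,\beta\in\{0,1,z\}$ define the linear operator $\partial_{\alpha,\beta}$ on $\mathcal{A}_z$ by $\partial_{\alpha,\beta}(e_{a_1}\cdots e_{a_n})=\sum_{i=1}^n\left(\delta_{\{a_i,a_{i+1}\},\{\alpha,\beta\}}-\delta_{\{a_{i-1},a_i\},\{\alpha,\beta\}}\right)e_{a_1}\cdots\widehat{e_{a_i}}\cdots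 e_{a_n}$, where $a_0=0$, $a_{n+1}=1$, the hat denotes omission, and $\delta_{S,T}=1$ if $S=T$ as sets and $0$ otherwise. These operators preserve $\mathcal{A}_z^0$. $\mathrm{Const}:\mathcal{A}_z\to\mathcal{A}$ is the linear map sending a word $e_{a_1}\cdots e_{a_n}$ to itself if all $a_i\in\{0,1\}$, and to $0$ if some $a_i=z$. The set of standard relations is $\mathcal{I}_{\mathrm{ST}}=\{w\in\mathcal{A}_z^0\mid \mathrm{Const}(\partial_{z,\alpha_1}\cdots\partial_{z,\alpha_r}w)=0\text{ for all }r\ge0\text{ and }\alpha_1,\dots,\alpha_r\in\{0,1\}\}$. *)

theory Defs
  imports "HOL-Analysis.Analysis" "HOL-Library.Poly_Mapping"
begin

datatype letter = E0 | E1 | Ez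

(* The free monoid on the letters, written additively because Poly_Mapping builds the
   monoid ring from an additive (not necessarily commutative) monoid of exponents. *)
datatype word = Word (letters: "letter list")

instantiation word :: monoid_add
begin
definition zero_word :: word where "zero_word = Word []"
definition plus_word :: "word \<Rightarrow> word \<Rightarrow> word" where
  "plus_word u v = Word (letters u @ letters v)"
instance by standard (simp_all add: zero_word_def plus_word_def)
end

(* The monoid ring of the free monoid, i.e. the free ring \<int>\<langle>e_0, e_1, e_z\<rangle>; its product is
   concatenation of words, extended bilinearly. *)
type_synonym Az = "word \<Rightarrow>\<^sub>0 int"

definition word_mon :: "letter list \<Rightarrow> Az" where
  "word_mon as = Poly_Mapping.single (Word as) 1"

definition gen :: "letter \<Rightarrow> Az" where
  "gen a = word_mon [a]"

definition lin_ext :: "(letter list \<Rightarrow> 'b::ring_1) \<Rightarrow> Az \<Rightarrow> 'b" where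
  "lin_ext f w = (\<Sum>u\<in>Poly_Mapping.keys w. of_int (Poly_Mapping.lookup w u) * f (letters u))"

definition Az0 :: "Az set" where
  "Az0 = {of_int m + of_int n * gen Ez
            + (\<Sum>a\<in>{E1, Ez}. \<Sum>b\<in>{E0, Ez}. gen a * u a b * gen b)
          | m n (u :: letter \<Rightarrow> letter \<Rightarrow> Az). True}"

fun label :: "complex \<Rightarrow> letter \<Rightarrow> complex" where
  "label z E0 = 0"
| "label z E1 = 1"
| "label z Ez = z"

(* Variables are indexed from 0. For m = 0 the space has exactly one point, of mass 1. *)
definition simplex_dom :: "nat \<Rightarrow> (nat \<Rightarrow> real) set" where
  "simplex_dom m = {t \<in> space (Pi\<^sub>M {..<m} (\<lambda>_. lborel)).
     (\<forall>i<m. 0 < t i \<and> t i < 1) \<and> (\<forall>i j. i < j \<and> j < m \<longrightarrow> t i < t j)}"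

definition L_word :: "complex \<Rightarrow> letter list \<Rightarrow> complex" where
  "L_word z as =
     set_lebesgue_integral (Pi\<^sub>M {..<length as} (\<lambda>_. lborel)) (simplex_dom (length as))
       (\<lambda>t. \<Prod>i<length as. 1 / (complex_of_real (t i) - label z (as ! i)))"

(* Meaningful on Az0 and for z outside [0,1], where all the integrals converge absolutely;
   elsewhere it is a totalisation without significance. *)
definition L :: "complex \<Rightarrow> Az \<Rightarrow> complex" where
  "L z = lin_ext (L_word z)"

(* In the list E0 # as @ [E1], position i holds a_i for 0 \<le> i \<le> n + 1. *)
definition del_word :: "letter \<Rightarrow> letter \<Rightarrow> letter list \<Rightarrow> Az" where
  "del_word \<alpha> \<beta> as = (let a = (\<lambda>i. (E0 # as @ [E1]) ! i) in
     \<Sum>i = 1..length as.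
       of_int (of_bool ({a i, a (i + 1)} = {\<alpha>, \<beta>}) - of_bool ({a (i - 1), a i} = {\<alpha>, \<beta>}))
         * word_mon (take (i - 1) as @ drop i as))"

definition del :: "letter \<Rightarrow> letter \<Rightarrow> Az \<Rightarrow> Az" where
  "del \<alpha> \<beta> = lin_ext (del_word \<alpha> \<beta>)"

definition Const :: "Az \<Rightarrow> Az" where
  "Const = lin_ext (\<lambda>as. if set as \<subseteq> {E0, E1} then word_mon as else 0)"

(* foldr makes del Ez \<alpha>_1 the outermost operator. *)
definition I_ST :: "Az set" where
  "I_ST = {w \<in> Az0. \<forall>\<alpha>s. set \<alpha>s \<subseteq> {E0, E1} \<longrightarrow> Const (foldr (del Ez) \<alpha>s w) = 0}"

lemma L_one: "L z 1 = 1"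
proof -
  have "simplex_dom 0 = {\<lambda>_. undefined}"
    by (auto simp: simplex_dom_def space_PiM)
  then have "L_word z [] = 1"
    by (simp add: L_word_def set_lebesgue_integral_def PiM_empty lebesgue_integral_count_space_finite)
  moreover have "Poly_Mapping.keys (1 :: Az) = {0}" by simp
  ultimately show ?thesis
    by (simp add: L_def lin_ext_def zero_word_def flip: single_one)
qed

end

theory Submission
  imports Defs
begin

text \<open>
  Integrating out the variables one at a time turns \<open>L\<close> of a word into an
  iterated integral \<open>F(x) = \<integral>\<^sub>0\<^sup>x G(t) dt / (t - a)\<close> evaluated at \<open>x = 1\<close>, where \<open>G\<close> belongs to a
  shorter word. Differentiating under the
  integral sign and comparing \<open>x\<close>-derivatives of both sides gives
  \<open>\<partial>\<^sub>z L(w) = L(\<partial>\<^sub>z\<^sub>,\<^sub>0 w) / z + L(\<partial>\<^sub>z\<^sub>,\<^sub>1 w) / (z - 1)\<close>. By induction on the length of the words, for a standard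
  relation \<open>w\<close> the right hand side vanishes, so \<open>L(w)\<close> is constant on the connected set
  \<open>\<complex> - [0,1]\<close>. As \<open>z\<close> tends to infinity, every word containing \<open>e\<^sub>z\<close> contributes \<open>0\<close>, and since
  \<open>Const w = 0\<close> there are no other words in \<open>w\<close>.

  All integrals are controlled by the single function \<open>1 / sqrt (1 - x) - 1\<close>: it vanishes at \<open>0\<close>
  to first order, so that dividing by \<open>t\<close> is harmless, and dividing by \<open>t (1 - t)\<close> and integrating
  reproduces it up to a factor \<open>2\<close>.
\<close>

section \<open>Improper integrals over initial segments of the unit interval\<close>

text \<open>The integrand may be singular at 0, so the fundamental theorem is applied on a compact
  interval \<open>{c..e}\<close> around \<open>x\<close>; the integral from 0 to \<open>c\<close>
  only adds a constant.\<close>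

lemma has_vector_derivative_primitive:
  fixes h :: "real \<Rightarrow> complex"
  assumes cont: "continuous_on {0<..<1} h"
    and int: "\<And>x. 0 < x \<Longrightarrow> x < 1 \<Longrightarrow> set_integrable lborel {0<..<x} h"
    and x: "0 < x" "x < 1"
  shows "((\<lambda>x. LINT t:{0<..<x}|lborel. h t) has_vector_derivative h x) (at x)"
proof -
  define c where "c = x / 2"
  define e where "e = (1 + x) / 2"
  have ce: "0 < c" "c < x" "x < e" "e < 1" using x by (auto simp: c_def e_def)
  have "((\<lambda>u. LBINT y=c..u. h y) has_vector_derivative h x) (at x within {c..e})"
    using ce by (intro interval_integral_FTC2 continuous_on_subset[OF cont]) auto
  then have "((\<lambda>u. LBINT y=c..u. h y) has_vector_derivative h x) (at x)"
    using ce by (simp add: at_within_Icc_at)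
  then have "((\<lambda>u. (LBINT y=0..c. h y) + (LBINT y=c..u. h y)) has_vector_derivative h x) (at x)"
    using has_vector_derivative_add[OF has_vector_derivative_const] by fastforce
  then show ?thesis
  proof (rule has_vector_derivative_transform_within_open)
    show "open {c<..<e}" "x \<in> {c<..<e}" using ce by auto
    fix u assume u: "u \<in> {c<..<e}"
    have "(LBINT y=0..ereal c. h y) + (LBINT y=c..u. h y) = (LBINT y=0..u. h y)"
    proof (rule interval_integral_sum)
      show "interval_lebesgue_integrable lborel (min 0 (min (ereal c) (ereal u)))
              (max 0 (max (ereal c) (ereal u))) h"
        using u ce int[of u]
        by (auto simp: interval_lebesgue_integrable_def min_def max_def zero_ereal_def)
    qed
    also have "\<dots> = (LINT t:{0<..<u}|lborel. h t)"
      using u ce by (simp add: interval_integral_Ioo zero_ereal_def)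
    finally show "(LBINT y=0..ereal c. h y) + (LBINT y=c..u. h y) = (LINT t:{0<..<u}|lborel. h t)" .
  qed
qed

text \<open>Only integrability up to \<open>b\<close> is available, as \<open>h\<close> may be
  singular there. Along an increasing sequence the domains exhaust \<open>{0<..<b}\<close>, and the
  integral is continuous along increasing unions.\<close>

lemma tendsto_primitive_at_left:
  fixes h :: "real \<Rightarrow> complex"
  assumes "set_integrable lborel {0<..<b} h" and "0 < b"
  shows "((\<lambda>x. LINT t:{0<..<x}|lborel. h t) \<longlongrightarrow> (LINT t:{0<..<b}|lborel. h t)) (at_left b)"
proof (rule tendsto_at_left_sequentially[OF \<open>0 < b\<close>])
  fix S :: "nat \<Rightarrow> real"
  assume S: "\<And>n. S n < b" "\<And>n. 0 < S n" "incseq S" "S \<longlonglongrightarrow> b"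
  have eq: "(\<Union>n. {0<..<S n}) = {0<..<b}"
  proof safe
    fix x n assume "x \<in> {0<..<S n}"
    with S(1)[of n] show "x \<in> {0<..<b}" by auto
  next
    fix x assume "x \<in> {0<..<b}"
    with order_tendstoD(1)[OF S(4), of x] show "x \<in> (\<Union>n. {0<..<S n})"
      by (force simp: eventually_at_top_linorder)
  qed
  have "(\<lambda>n. set_lebesgue_integral lborel {0<..<S n} h) \<longlonglongrightarrow>
          set_lebesgue_integral lborel (\<Union>n. {0<..<S n}) h"
  proof (rule set_integral_cont_up)
    show "incseq (\<lambda>n. {0<..<S n})"
      using S(3) by (fastforce simp: incseq_def)
  qed (use assms eq in auto)
  then show "(\<lambda>n. LINT t:{0<..<S n}|lborel. h t) \<longlonglongrightarrow> (LINT t:{0<..<b}|lborel. h t)"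
    by (simp add: eq)
qed

lemma set_integrable_dominated:
  fixes h :: "real \<Rightarrow> complex" and g :: "real \<Rightarrow> real"
  assumes "continuous_on {0<..<x} h" "set_integrable lborel {0<..<x} g"
    and "\<And>t. 0 < t \<Longrightarrow> t < x \<Longrightarrow> norm (h t) \<le> g t"
  shows "set_integrable lborel {0<..<x} h"
proof (rule set_integrable_bound[OF assms(2)])
  show "set_borel_measurable lborel {0<..<x} h"
    using set_measurable_continuous_on[OF _ assms(1)] unfolding set_borel_measurable_def by simp
  show "AE t in lborel. t \<in> {0<..<x} \<longrightarrow> norm (h t) \<le> norm (g t)"
    using assms(3) by (intro AE_I2) force
qed

lemma norm_set_integral_dominated:
  fixes h :: "real \<Rightarrow> complex" and g :: "real \<Rightarrow> real"
  assumes "set_integrable lborel {0<..<x} h" "set_integrable lborel {0<..<x} g"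
    and "\<And>t. 0 < t \<Longrightarrow> t < x \<Longrightarrow> norm (h t) \<le> g t"
  shows "norm (LINT t:{0<..<x}|lborel. h t) \<le> (LINT t:{0<..<x}|lborel. g t)"
  using assms unfolding set_lebesgue_integral_def set_integrable_def
  by (intro Bochner_Integration.integral_norm_bound_integral) (auto simp: indicator_def)

text \<open>Differentiation under the integral sign: by the mean value inequality on the convex
  ball, \<open>H\<close> dominates the difference quotients as well, and dominated convergence
  applies to them.\<close>

lemma has_field_derivative_integral_dominated:
  fixes f f' :: "complex \<Rightarrow> 'a \<Rightarrow> complex"
  assumes "0 < r"
    and int: "\<And>\<zeta>. \<zeta> \<in> ball z r \<Longrightarrow> integrable M (f \<zeta>)"
    and deriv: "\<And>\<zeta> t. \<zeta> \<in> ball z r \<Longrightarrow> t \<in> space M \<Longrightarrow>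
                  ((\<lambda>\<zeta>. f \<zeta> t) has_field_derivative f' \<zeta> t) (at \<zeta>)"
    and bound: "\<And>\<zeta> t. \<zeta> \<in> ball z r \<Longrightarrow> t \<in> space M \<Longrightarrow> norm (f' \<zeta> t) \<le> H t"
    and H: "integrable M H"
    and meas: "f' z \<in> borel_measurable M"
  shows "((\<lambda>\<zeta>. LINT t|M. f \<zeta> t) has_field_derivative (LINT t|M. f' z t)) (at z)"
  unfolding has_field_derivative_iff
proof (rule tendsto_at_iff_sequentially[THEN iffD2], intro allI impI)
  fix X :: "nat \<Rightarrow> complex"
  assume X: "\<forall>i. X i \<in> UNIV - {z}" and lim: "X \<longlonglongrightarrow> z"
  \<comment> \<open>Terms outside the ball are replaced by a fixed point of the ball different from
    \<open>z\<close>, so that the domination holds for every index and not only eventually.\<close>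
  define Y where "Y = (\<lambda>n. if X n \<in> ball z r then X n else z + of_real (r/2))"
  have Y: "Y n \<in> ball z r" "Y n \<noteq> z" for n
    using X \<open>0 < r\<close> by (auto simp: Y_def dist_norm)
  have ev: "\<forall>\<^sub>F n in sequentially. X n = Y n"
    using tendstoD[OF lim \<open>0 < r\<close>]
    by eventually_elim (simp add: Y_def dist_commute)
  have limY: "Y \<longlonglongrightarrow> z"
    using lim ev by (rule Lim_transform_eventually)
  have q: "(\<lambda>n. LINT t|M. (f (Y n) t - f z t) / (Y n - z)) \<longlonglongrightarrow> (LINT t|M. f' z t)"
  proof (rule integral_dominated_convergence[where w = H])
    show "f' z \<in> borel_measurable M" by fact
    show "(\<lambda>t. (f (Y n) t - f z t) / (Y n - z)) \<in> borel_measurable M" for n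
      using int[OF Y(1)[of n]] int[of z] \<open>0 < r\<close> by auto
    show "integrable M H" by fact
    show "AE t in M. (\<lambda>n. (f (Y n) t - f z t) / (Y n - z)) \<longlonglongrightarrow> f' z t"
    proof (rule AE_I2)
      fix t assume t: "t \<in> space M"
      have "((\<lambda>\<zeta>. (f \<zeta> t - f z t) / (\<zeta> - z)) \<longlongrightarrow> f' z t) (at z)"
        using deriv[OF _ t, of z] \<open>0 < r\<close> by (simp add: has_field_derivative_iff)
      then show "(\<lambda>n. (f (Y n) t - f z t) / (Y n - z)) \<longlonglongrightarrow> f' z t"
        using Y(2) limY by (auto simp: tendsto_at_iff_sequentially comp_def)
    qed
    show "AE t in M. norm ((f (Y n) t - f z t) / (Y n - z)) \<le> H t" for n
    proof (rule AE_I2)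
      fix t assume t: "t \<in> space M"
      have "norm (f (Y n) t - f z t) \<le> H t * norm (Y n - z)"
      proof (rule field_differentiable_bound[of "ball z r"])
        show "((\<lambda>\<zeta>. f \<zeta> t) has_field_derivative f' \<zeta> t) (at \<zeta> within ball z r)"
          if "\<zeta> \<in> ball z r" for \<zeta>
          using deriv[OF that t] by (rule has_field_derivative_at_within)
      qed (use Y \<open>0 < r\<close> bound t in auto)
      then show "norm ((f (Y n) t - f z t) / (Y n - z)) \<le> H t"
        using Y(2)[of n] by (simp add: norm_divide divide_le_eq)
    qed
  qed
  have "(LINT t|M. (f (Y n) t - f z t) / (Y n - z)) =
          ((LINT t|M. f (Y n) t) - (LINT t|M. f z t)) / (Y n - z)" for n
    using int[OF Y(1)[of n]] int[of z] \<open>0 < r\<close> by simp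
  with q have "(\<lambda>n. ((LINT t|M. f (Y n) t) - (LINT t|M. f z t)) / (Y n - z)) \<longlonglongrightarrow> (LINT t|M. f' z t)"
    by (simp only:)
  then show "((\<lambda>y. ((LINT t|M. f y t) - (LINT t|M. f z t)) / (y - z)) \<circ> X) \<longlonglongrightarrow> (LINT t|M. f' z t)"
    by (rule Lim_transform_eventually) (use ev in eventually_elim, simp)
qed

section \<open>The majorants and their integrals\<close>

definition bnd :: "real \<Rightarrow> real" where
  "bnd x = 1 / sqrt (1 - x) - 1"

text \<open>What remains of the bound after division by \<open>t - a\<close>: for \<open>E1\<close>
  a factor \<open>1 / (1 - t)\<close> appears, for \<open>E0\<close> the zero of \<open>bnd\<close>
  at 0 absorbs the factor \<open>1 / t\<close>, and for \<open>Ez\<close> the denominator is bounded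
  away from 0.\<close>

definition majorant :: "letter \<Rightarrow> real \<Rightarrow> real" where
  "majorant a t = (if a = E1 then 1 / ((1 - t) * sqrt (1 - t)) else 1 / sqrt (1 - t))"

lemma bnd_nonneg: "0 \<le> x \<Longrightarrow> x < 1 \<Longrightarrow> 0 \<le> bnd x"
  by (simp add: bnd_def)

text \<open>The substitution \<open>s = sqrt (1 - t)\<close> reduces all three bounds to elementary
  inequalities on 0 < s < 1. The second one later turns a term of order \<open>t\<close> into a
  multiple of \<open>bnd t\<close>.\<close>

lemma bnd_le:
  assumes "0 < t" "t < 1"
  shows "bnd t \<le> t / sqrt (1 - t)" "t \<le> 2 * bnd t" "bnd t \<le> 1 / sqrt (1 - t)"
proof -
  define s where "s = sqrt (1 - t)"
  have s: "0 < s" "s < 1" "t = 1 - s\<^sup>2" using assms by (auto simp: s_def)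
  have g: "bnd t = 1 / s - 1" by (simp add: bnd_def s_def)
  have "s * s \<le> s" using s by (simp add: mult_left_le)
  then have "1 / s - 1 \<le> (1 - s\<^sup>2) / s" 
    using s(1) by (simp add: field_simps power2_eq_square)
  then show "bnd t \<le> t / sqrt (1 - t)"
    unfolding s_def[symmetric] g by (simp add: s(3)[symmetric])
  have "s + s * s \<le> 2" using \<open>s * s \<le> s\<close> s(2) by linarith
  \<comment> \<open>Expanded, the product is 2 (1 - s) - s (1 - s^2).\<close>
  then have "0 \<le> (1 - s) * (2 - s * (1 + s))"
    using s(2) by (intro mult_nonneg_nonneg) (auto simp: distrib_left)
  then have "(1 - s\<^sup>2) * s \<le> 2 * (1 - s)" 
    by (simp add: algebra_simps power2_eq_square)
  then have "1 - s\<^sup>2 \<le> 2 * (1 / s - 1)"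
    using s(1) by (simp add: field_simps)
  then show "t \<le> 2 * bnd t" unfolding g using s(3) by linarith
  show "bnd t \<le> 1 / sqrt (1 - t)" by (simp add: bnd_def)
qed

text \<open>For \<open>E1\<close> the primitive \<open>2 / sqrt (1 - t)\<close> gives exactly
  \<open>2 * bnd x\<close>; the majorants of the other letters lie below that of
  \<open>E1\<close>.\<close>

lemma majorant_integral:
  assumes "0 < x" "x < 1"
  shows "set_integrable lborel {0<..<x} (majorant a)"
    and "(LINT t:{0<..<x}|lborel. majorant a t) \<le> 2 * bnd x"
proof -
  have d: "((\<lambda>t. 2 / sqrt (1 - t)) has_field_derivative majorant E1 t) (at t)" if "t < 1" for t
    using that
    by (auto intro!: derivative_eq_intros simp: majorant_def field_simps)
  have c: "isCont (majorant b) t" if "t < 1" for t b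
    using that unfolding majorant_def by (cases b) (auto intro!: continuous_intros)
  have lim: "((\<lambda>t. 2 / sqrt (1 - t)) \<longlongrightarrow> 2 / sqrt (1 - y)) (at y within A)" if "y < 1" for y A
    using that by (auto intro!: tendsto_eq_intros)
  have prems: "0 < ereal x"
    "\<And>t. 0 < ereal t \<Longrightarrow> ereal t < ereal x \<Longrightarrow> ((\<lambda>t. 2 / sqrt (1 - t)) has_real_derivative majorant E1 t) (at t)"
    "\<And>t. 0 < ereal t \<Longrightarrow> ereal t < ereal x \<Longrightarrow> isCont (majorant E1) t"
    "AE t in lborel. 0 < ereal t \<longrightarrow> ereal t < ereal x \<longrightarrow> 0 \<le> majorant E1 t"
    "(((\<lambda>t. 2 / sqrt (1 - t)) \<circ> real_of_ereal) \<longlongrightarrow> 2 / sqrt (1 - 0)) (at_right 0)"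
    "(((\<lambda>t. 2 / sqrt (1 - t)) \<circ> real_of_ereal) \<longlongrightarrow> 2 / sqrt (1 - x)) (at_left (ereal x))"
    using assms d c lim[of 0] lim[of x]
    by (simp_all only: ereal_tendsto_simps zero_ereal_def) (auto simp: majorant_def)
  note ftc = interval_integral_FTC_nonneg[OF prems]
  have i: "set_integrable lborel {0<..<x} (majorant E1)"
    using ftc(1) by (simp add: zero_ereal_def)
  have v: "(LINT t:{0<..<x}|lborel. majorant E1 t) = 2 * bnd x"
    using ftc(2) assms by (simp add: zero_ereal_def interval_integral_Ioo bnd_def)
  have le: "0 \<le> majorant a t" "majorant a t \<le> majorant E1 t" if "0 < t" "t < 1" for t
    using that by (auto simp: majorant_def field_simps)
  show ia: "set_integrable lborel {0<..<x} (majorant a)"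
  proof (rule set_integrable_bound[OF i])
    show "set_borel_measurable lborel {0<..<x} (majorant a)"
      using set_measurable_continuous_on[of "{0<..<x}" "majorant a"] assms c
      unfolding set_borel_measurable_def
      by (simp add: continuous_at_imp_continuous_on)
    show "AE t in lborel. t \<in> {0<..<x} \<longrightarrow> norm (majorant a t) \<le> norm (majorant E1 t)"
    proof (intro AE_I2 impI)
      fix t assume "t \<in> {0<..<x}"
      with le[of t] assms show "norm (majorant a t) \<le> norm (majorant E1 t)" by auto
    qed
  qed
  show "(LINT t:{0<..<x}|lborel. majorant a t) \<le> 2 * bnd x"
    unfolding v[symmetric] using assms le by (intro set_integral_mono ia i) auto
qed

text \<open>Here the primitive \<open>- 2 * sqrt (1 - t)\<close> stays continuous at 1. This is
  where the convergence condition at the upper end point enters.\<close>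

lemma majorant_integral_1:
  assumes "a \<noteq> E1"
  shows "set_integrable lborel {0<..<1} (majorant a)"
    and "(LINT t:{0<..<1}|lborel. majorant a t) = 2"
proof -
  have d: "((\<lambda>t. - 2 * sqrt (1 - t)) has_field_derivative majorant a t) (at t)" if "t < 1" for t
    using that assms
    by (auto intro!: derivative_eq_intros simp: majorant_def field_simps)
  have c: "isCont (majorant a) t" if "t < 1" for t
    using that assms unfolding majorant_def by (auto intro!: continuous_intros)
  have lim: "((\<lambda>t. - 2 * sqrt (1 - t)) \<longlongrightarrow> - 2 * sqrt (1 - y)) (at y within A)" for y A
    by (intro tendsto_intros)
  have prems: "(0::ereal) < 1"
    "\<And>t. 0 < ereal t \<Longrightarrow> ereal t < 1 \<Longrightarrow> ((\<lambda>t. - 2 * sqrt (1 - t)) has_real_derivative majorant a t) (at t)"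
    "\<And>t. 0 < ereal t \<Longrightarrow> ereal t < 1 \<Longrightarrow> isCont (majorant a) t"
    "AE t in lborel. 0 < ereal t \<longrightarrow> ereal t < 1 \<longrightarrow> 0 \<le> majorant a t"
    "(((\<lambda>t. - 2 * sqrt (1 - t)) \<circ> real_of_ereal) \<longlongrightarrow> - 2 * sqrt (1 - 0)) (at_right 0)"
    "(((\<lambda>t. - 2 * sqrt (1 - t)) \<circ> real_of_ereal) \<longlongrightarrow> - 2 * sqrt (1 - 1)) (at_left 1)"
    using assms d c lim[of 0] lim[of 1]
    by (simp_all only: ereal_tendsto_simps zero_ereal_def one_ereal_def) (auto simp: majorant_def)
  note ftc = interval_integral_FTC_nonneg[OF prems]
  show "set_integrable lborel {0<..<1} (majorant a)"
    using ftc(1) by (simp add: zero_ereal_def one_ereal_def)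
  show "(LINT t:{0<..<1}|lborel. majorant a t) = 2"
    using ftc(2) by (simp add: zero_ereal_def one_ereal_def interval_integral_Ioo)
qed

section \<open>Iterated integrals\<close>

text \<open>A quantitative form of \<open>z\<close> lying off the unit interval. The bounds below
  depend on \<open>z\<close> only through \<open>d\<close>, which makes them locally uniform in
  \<open>z\<close> and allows \<open>d\<close> to tend to infinity at the end.\<close>

definition far :: "real \<Rightarrow> complex \<Rightarrow> bool" where
  "far d z \<longleftrightarrow> 0 < d \<and> (\<forall>t\<in>{0..1}. d \<le> norm (complex_of_real t - z))"

lemma far_exists:
  assumes "z \<notin> complex_of_real ` {0..1}"
  obtains d where "far d z"
proof -
  have "closed (complex_of_real ` {0..1})"
    by (intro compact_imp_closed compact_continuous_image continuous_intros) auto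
  from separate_point_closed[OF this assms] obtain d
    where "0 < d" "\<forall>y\<in>complex_of_real ` {0..1}. d \<le> dist z y" by blast
  then have "far d z" by (auto simp: far_def dist_norm norm_minus_commute)
  then show thesis by (rule that)
qed

lemma far_ball:
  assumes "far d z" "\<zeta> \<in> ball z (d / 2)"
  shows "far (d / 2) \<zeta>"
  unfolding far_def
proof (intro conjI ballI)
  show "0 < d / 2" using assms by (simp add: far_def)
  fix t :: real assume "t \<in> {0..1}"
  then have "d \<le> norm (complex_of_real t - z)" using assms by (simp add: far_def)
  also have "\<dots> \<le> norm (complex_of_real t - \<zeta>) + norm (\<zeta> - z)"
    by (metis diff_add_cancel norm_triangle_ineq add_diff_eq)
  also have "norm (\<zeta> - z) < d / 2"
    using assms by (simp add: dist_norm norm_minus_commute)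
  finally show "d / 2 \<le> norm (complex_of_real t - \<zeta>)" by simp
qed

lemma far_large:
  assumes "0 < d" "1 + d \<le> norm z"
  shows "far d z"
  unfolding far_def
proof (intro conjI ballI)
  fix t :: real assume "t \<in> {0..1}"
  then have "norm z - 1 \<le> norm z - norm (complex_of_real t)" by simp
  also have "\<dots> \<le> norm (complex_of_real t - z)"
    by (metis norm_minus_commute norm_triangle_ineq2)
  finally show "d \<le> norm (complex_of_real t - z)" using assms by simp
qed (use assms in auto)

lemma far_neq: "far d z \<Longrightarrow> 0 \<le> t \<Longrightarrow> t \<le> 1 \<Longrightarrow> complex_of_real t \<noteq> z"
  by (force simp: far_def)

lemma label_neq: "far d z \<Longrightarrow> 0 < t \<Longrightarrow> t < 1 \<Longrightarrow> complex_of_real t \<noteq> label z a"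
  by (cases a) (auto simp: far_neq)

definition letter_wt :: "real \<Rightarrow> letter \<Rightarrow> real" where
  "letter_wt d a = (if a = Ez then 1 / d else 1)"

text \<open>Each integration costs the factor 2 of \<open>majorant_integral\<close>. The factor
  \<open>1 / d\<close> for each \<open>Ez\<close> is what makes words containing \<open>Ez\<close>
  decay as \<open>z\<close> moves to infinity.\<close>

definition word_wt :: "real \<Rightarrow> letter list \<Rightarrow> real" where
  "word_wt d u = (\<Prod>a\<leftarrow>u. 2 * letter_wt d a)"

text \<open>The iterated integral of the empty word is 1 and does not vanish at 0, hence the
  separate case.\<close>

definition word_bnd :: "letter list \<Rightarrow> real \<Rightarrow> real" where
  "word_bnd u t = (if u = [] then 1 else bnd t)"

lemma letter_wt_pos: "0 < d \<Longrightarrow> 0 < letter_wt d a"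
  by (simp add: letter_wt_def)

lemma word_wt_pos: "0 < d \<Longrightarrow> 0 < word_wt d u"
  by (induction u) (auto simp: word_wt_def letter_wt_pos)

lemma word_wt_simps [simp]:
  "word_wt d [] = 1" "word_wt d (a # u) = 2 * letter_wt d a * word_wt d u"
  by (simp_all add: word_wt_def)

text \<open>The one-letter estimate behind all later bounds. For \<open>E0\<close> the division by
  \<open>t\<close> is paid for by the zero of \<open>bnd\<close> at 0, which the empty word does not
  have; this explains the excluded combination.\<close>

lemma letter_bound:
  assumes "far d z" "0 < t" "t < 1" "u \<noteq> [] \<or> a \<noteq> E0" "norm v \<le> c * word_bnd u t" "0 \<le> c"
  shows "norm (v / (complex_of_real t - label z a)) \<le> c * letter_wt d a * majorant a t"
proof -
  have pg: "0 \<le> word_bnd u t" "word_bnd u t \<le> 1 / sqrt (1 - t)"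
    using assms bnd_nonneg[of t] bnd_le[of t] by (auto simp: word_bnd_def)
  have *: "word_bnd u t / norm (complex_of_real t - label z a) \<le> letter_wt d a * majorant a t"
  proof (cases a)
    case E0
    then have "word_bnd u t / norm (complex_of_real t - label z a) = bnd t / t"
      using assms by (simp add: word_bnd_def)
    also have "\<dots> \<le> 1 / sqrt (1 - t)"
      using bnd_le(1)[of t] assms by (simp add: field_simps)
    finally show ?thesis using E0 by (simp add: letter_wt_def majorant_def)
  next
    case E1
    have "norm (complex_of_real t - 1) = 1 - t"
      using assms(3) by (metis abs_minus_commute abs_of_pos diff_gt_0_iff_gt norm_of_real of_real_1 of_real_diff)
    then have "word_bnd u t / norm (complex_of_real t - label z a) = word_bnd u t / (1 - t)"
      using E1 by simp
    also have "\<dots> \<le> (1 / sqrt (1 - t)) / (1 - t)"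
      using assms pg by (intro divide_right_mono) auto
    finally show ?thesis using E1 by (simp add: letter_wt_def majorant_def mult.commute)
  next
    case Ez
    have "d \<le> norm (complex_of_real t - z)" "0 < d" using assms by (auto simp: far_def)
    then have "word_bnd u t / norm (complex_of_real t - z) \<le> (1 / sqrt (1 - t)) / d"
      using pg assms by (intro frac_le) auto
    then show ?thesis using Ez by (simp add: letter_wt_def majorant_def mult.commute)
  qed
  have "norm (v / (complex_of_real t - label z a)) \<le> c * word_bnd u t / norm (complex_of_real t - label z a)"
    using assms(5) by (simp add: norm_divide divide_right_mono)
  also have "\<dots> = c * (word_bnd u t / norm (complex_of_real t - label z a))" by simp
  also have "\<dots> \<le> c * (letter_wt d a * majorant a t)"
    using * \<open>0 \<le> c\<close> by (rule mult_left_mono)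
  finally show ?thesis by (simp add: mult.assoc)
qed

text \<open>The first list element is the letter of the outermost integration, so words appear reversed with
  respect to \<open>L_word\<close>. The divergent integral of \<open>dt / t\<close> gets the junk value \<open>0\<close>, hence so does
  every word ending in \<open>E0\<close>; in all formulas below such words have coefficient \<open>0\<close>.\<close>

primrec iint :: "complex \<Rightarrow> letter list \<Rightarrow> real \<Rightarrow> complex" where
  "iint z [] x = 1"
| "iint z (a # u) x = (if a = E0 \<and> u = [] then 0
     else LINT t:{0<..<x}|lborel. iint z u t / (complex_of_real t - label z a))"


text \<open>Bound and continuity are proved in one induction, since a further integration uses both:
  the bound for domination, continuity for measurability and for the fundamental theorem.\<close>

lemma iint_bound_cont:
  assumes "far d z"
  shows "(\<forall>x. 0 < x \<and> x < 1 \<longrightarrow> norm (iint z u x) \<le> word_wt d u * word_bnd u x) \<and>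
         continuous_on {0<..<1} (iint z u)"
proof (induction u)
  case Nil
  then show ?case by (simp add: word_bnd_def)
next
  case (Cons a u)
  have d: "0 < d" using assms by (simp add: far_def)
  show ?case
  proof (cases "a = E0 \<and> u = []")
    case True
    then show ?thesis
      using word_wt_pos[OF d, of "[a]"] bnd_nonneg by (auto simp: word_bnd_def)
  next
    case False
    define h where "h = (\<lambda>t. iint z u t / (complex_of_real t - label z a))"
    define c where "c = word_wt d u * letter_wt d a"
    have c: "0 \<le> c" using word_wt_pos[OF d, of u] letter_wt_pos[OF d, of a] by (simp add: c_def)
    have F: "iint z (a # u) = (\<lambda>x. LINT t:{0<..<x}|lborel. h t)"
      using False by (auto simp: h_def)
    have b: "norm (h t) \<le> c * majorant a t" if "0 < t" "t < 1" for t
      unfolding h_def c_def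
      by (rule letter_bound) (use that assms False Cons.IH word_wt_pos[OF d, of u] in auto)
    have hc: "continuous_on {0<..<1} h"
      unfolding h_def using label_neq[OF assms] Cons.IH by (intro continuous_intros) auto
    have hi: "set_integrable lborel {0<..<x} h" if "0 < x" "x < 1" for x
    proof (rule set_integrable_dominated)
      show "continuous_on {0<..<x} h" using hc by (rule continuous_on_subset) (use that in auto)
      show "set_integrable lborel {0<..<x} (\<lambda>t. c * majorant a t)"
        using majorant_integral(1)[OF that] by simp
    qed (use b that in auto)
    have "norm (iint z (a # u) x) \<le> word_wt d (a # u) * word_bnd (a # u) x" if "0 < x" "x < 1" for x
    proof -
      have "norm (iint z (a # u) x) \<le> (LINT t:{0<..<x}|lborel. c * majorant a t)"
        unfolding F
        by (rule norm_set_integral_dominated[OF hi]) (use that b majorant_integral(1) in auto)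
      also have "\<dots> = c * (LINT t:{0<..<x}|lborel. majorant a t)" by simp
      also have "\<dots> \<le> c * (2 * bnd x)"
        using majorant_integral(2)[OF that] c by (intro mult_left_mono)
      finally show ?thesis by (simp add: c_def word_bnd_def mult_ac)
    qed
    moreover have "continuous_on {0<..<1} (iint z (a # u))"
    proof (rule continuous_at_imp_continuous_on, safe)
      fix x :: real assume "x \<in> {0<..<1}"
      then show "isCont (iint z (a # u)) x"
        using has_vector_derivative_primitive[OF hc hi, of x] unfolding F
        by (intro has_vector_derivative_continuous) auto
    qed
    ultimately show ?thesis by blast
  qed
qed

lemmas iint_bound = iint_bound_cont[THEN conjunct1, rule_format, OF _ conjI]
lemmas iint_cont = iint_bound_cont[THEN conjunct2]

definition integrand :: "complex \<Rightarrow> letter \<Rightarrow> letter list \<Rightarrow> real \<Rightarrow> complex" where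
  "integrand z a u t = iint z u t / (complex_of_real t - label z a)"

lemma iint_Cons: "a \<noteq> E0 \<or> u \<noteq> [] \<Longrightarrow> iint z (a # u) x = (LINT t:{0<..<x}|lborel. integrand z a u t)"
  by (auto simp: integrand_def)

lemma iint_Cons_fun:
  "a \<noteq> E0 \<or> u \<noteq> [] \<Longrightarrow> iint z (a # u) = (\<lambda>x. LINT t:{0<..<x}|lborel. integrand z a u t)"
  using iint_Cons by blast

lemma iint_E0: "iint z [E0] = (\<lambda>x. 0)" and iint_Nil: "iint z [] = (\<lambda>x. 1)"
  by auto

lemma majorant_integrable:
  assumes "0 < x" "x \<le> 1" "x < 1 \<or> a \<noteq> E1"
  shows "set_integrable lborel {0<..<x} (majorant a)"
  using majorant_integral(1)[of x a] majorant_integral_1(1)[of a] assms by (cases "x = 1") auto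

lemma integrand_bound:
  assumes "far d z" "a \<noteq> E0 \<or> u \<noteq> []" "0 < t" "t < 1"
  shows "norm (integrand z a u t) \<le> word_wt d u * letter_wt d a * majorant a t"
  unfolding integrand_def
  by (rule letter_bound)
     (use assms iint_bound[of d z t u] word_wt_pos[of d u] in \<open>auto simp: far_def\<close>)

lemma integrand_cont:
  assumes "far d z"
  shows "continuous_on {0<..<1} (integrand z a u)"
  unfolding integrand_def using label_neq[OF assms] iint_cont[OF assms]
  by (intro continuous_intros) auto

lemma integrand_integrable:
  assumes "far d z" "a \<noteq> E0 \<or> u \<noteq> []" "0 < x" "x \<le> 1" "x < 1 \<or> a \<noteq> E1"
  shows "set_integrable lborel {0<..<x} (integrand z a u)"
proof (rule set_integrable_dominated)
  show "continuous_on {0<..<x} (integrand z a u)"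
    by (rule continuous_on_subset[OF integrand_cont[OF assms(1)]]) (use assms in auto)
  show "set_integrable lborel {0<..<x} (\<lambda>t. word_wt d u * letter_wt d a * majorant a t)"
    using majorant_integrable[OF assms(3-5)] by simp
qed (use integrand_bound[OF assms(1,2)] assms in auto)

text \<open>The bound by \<open>bnd x\<close> degenerates as \<open>x\<close> tends to 1. Since the
  outermost letter is not \<open>E1\<close>, its majorant has total integral 2, which is just the
  factor 2 in \<open>word_wt\<close>.\<close>

lemma iint_bound_1:
  assumes "far d z" "u = [] \<or> hd u \<noteq> E1"
  shows "norm (iint z u 1) \<le> word_wt d u"
proof (cases u)
  case (Cons a v)
  have d: "0 < d" using assms by (simp add: far_def)
  show ?thesis
  proof (cases "a = E0 \<and> v = []")
    case True
    then show ?thesis using Cons word_wt_pos[OF d, of u] by simp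
  next
    case False
    then have *: "a \<noteq> E0 \<or> v \<noteq> []" by blast
    have a: "a \<noteq> E1" using assms Cons by simp
    have "norm (iint z u 1) \<le> (LINT t:{0<..<1}|lborel. word_wt d v * letter_wt d a * majorant a t)"
      unfolding Cons iint_Cons[OF *]
      by (rule norm_set_integral_dominated[OF integrand_integrable])
         (use assms * a majorant_integral_1(1)[OF a] integrand_bound[OF assms(1) *] in auto)
    also have "\<dots> = word_wt d u"
      using majorant_integral_1(2)[OF a] by (simp add: Cons)
    finally show ?thesis .
  qed
qed auto

lemma iint_deriv:
  assumes "far d z" "a \<noteq> E0 \<or> u \<noteq> []" "0 < x" "x < 1"
  shows "(iint z (a # u) has_vector_derivative integrand z a u x) (at x)"
proof -
  have "((\<lambda>x. LINT t:{0<..<x}|lborel. integrand z a u t) has_vector_derivative integrand z a u x) (at x)"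
    by (rule has_vector_derivative_primitive[OF integrand_cont[OF assms(1)]])
       (use assms integrand_integrable[OF assms(1,2)] in auto)
  then show ?thesis unfolding iint_Cons_fun[OF assms(2)] .
qed

lemma iint_tendsto_left:
  assumes "far d z" "u = [] \<or> hd u \<noteq> E1"
  shows "(iint z u \<longlongrightarrow> iint z u 1) (at_left 1)"
proof (cases u)
  case (Cons a v)
  show ?thesis
  proof (cases "a = E0 \<and> v = []")
    case False
    then have *: "a \<noteq> E0 \<or> v \<noteq> []" by blast
    show ?thesis
      unfolding Cons iint_Cons_fun[OF *]
      using tendsto_primitive_at_left[OF integrand_integrable[OF assms(1) *]] assms Cons by simp
  qed (use Cons iint_E0 in simp)
qed (use iint_Nil in simp)

section \<open>Derivative of iterated integrals in the parameter\<close>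

text \<open>The coefficient of \<open>dz\<close> in \<open>d log (p - q)\<close>.\<close>

definition dlog :: "complex \<Rightarrow> letter \<Rightarrow> letter \<Rightarrow> complex" where
  "dlog z p q = of_bool ({p, q} = {Ez, E0}) / z + of_bool ({p, q} = {Ez, E1}) / (z - 1)"

lemma dlog_simps [simp]:
  "dlog z E0 E0 = 0" "dlog z E0 E1 = 0" "dlog z E1 E0 = 0" "dlog z E1 E1 = 0" "dlog z Ez Ez = 0"
  "dlog z Ez E0 = 1 / z" "dlog z E0 Ez = 1 / z" "dlog z Ez E1 = 1 / (z - 1)" "dlog z E1 Ez = 1 / (z - 1)"
  by (auto simp: dlog_def doubleton_eq_iff)

lemma dlog_bound:
  assumes "far d z"
  shows "norm (dlog z p q) \<le> 1 / d"
proof -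
  have "\<forall>t\<in>{0..1}. d \<le> norm (complex_of_real t - z)" "0 < d" using assms by (auto simp: far_def)
  from this(1)[rule_format, of 0] this(1)[rule_format, of 1] this(2) show ?thesis
    by (cases p; cases q) (auto simp: norm_divide norm_minus_commute intro!: divide_left_mono mult_pos_pos
        elim: less_le_trans)
qed

text \<open>Goncharov's differential without the terms involving the upper end point of integration, with
  the letters in reversed order.\<close>

fun inner_del :: "complex \<Rightarrow> letter list \<Rightarrow> (letter list \<Rightarrow> complex) \<Rightarrow> complex" where
  "inner_del z [] f = 0"
| "inner_del z [a] f = - dlog z E0 a * f []"
| "inner_del z (a # b # u) f =
     inner_del z (b # u) (\<lambda>v. f (a # v)) + dlog z b a * (f (a # u) - f (b # u))"

lemma inner_del_divide: "inner_del z u (\<lambda>v. f v / c) = inner_del z u f / c"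
  by (induction z u f rule: inner_del.induct) (auto simp: add_divide_distrib diff_divide_distrib right_diff_distrib)

text \<open>There are at most two terms per letter, each with a coefficient of norm at most
  \<open>1 / d\<close> by \<open>dlog_bound\<close>.\<close>

lemma inner_del_bound:
  assumes "far d z" "0 \<le> M" "\<And>v. Suc (length v) = length u \<Longrightarrow> norm (f v) \<le> M"
  shows "norm (inner_del z u f) \<le> 2 * real (length u) * M / d"
  using assms
proof (induction z u f rule: inner_del.induct)
  case (1 z f)
  then show ?case by simp
next
  case (2 z a f)
  have "0 < d" using 2 by (simp add: far_def)
  have "norm (inner_del z [a] f) \<le> 1 / d * M"
    unfolding inner_del.simps norm_mult norm_minus_cancel
    using 2 dlog_bound[OF 2(1)] \<open>0 < d\<close> by (intro mult_mono) auto
  also have "\<dots> \<le> 2 * M / d" using 2 \<open>0 < d\<close> by (simp add: divide_right_mono)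
  finally show ?case by simp
next
  case (3 z a b u f)
  have "0 < d" using 3 by (simp add: far_def)
  have 1: "norm (inner_del z (b # u) (\<lambda>v. f (a # v))) \<le> 2 * real (length (b # u)) * M / d"
    by (rule "3.IH") (use "3.prems" in auto)
  have "norm (f (a # u) - f (b # u)) \<le> M + M"
    by (rule order_trans[OF norm_triangle_ineq4 add_mono]) (use "3.prems" in auto)
  then have 2: "norm (dlog z b a * (f (a # u) - f (b # u))) \<le> 1 / d * (M + M)"
    unfolding norm_mult using dlog_bound[OF "3.prems"(1)] \<open>0 < d\<close> by (intro mult_mono) auto
  have "norm (inner_del z (a # b # u) f) \<le> 2 * real (length (b # u)) * M / d + 1 / d * (M + M)"
    unfolding inner_del.simps by (rule order_trans[OF norm_triangle_ineq add_mono[OF 1 2]])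
  also have "\<dots> = 2 * real (length (a # b # u)) * M / d" using \<open>0 < d\<close> by (simp add: field_simps)
  finally show ?case .
qed

text \<open>\<open>inner_del\<close> is a finite linear combination of values of \<open>f\<close> on
  words with one letter fewer, so limits pass through it; the next lemma does the same for
  derivatives.\<close>

lemma inner_del_tendsto:
  assumes "\<And>v. Suc (length v) = length u \<Longrightarrow> ((\<lambda>x. f x v) \<longlongrightarrow> g v) F"
  shows "((\<lambda>x. inner_del z u (f x)) \<longlongrightarrow> inner_del z u g) F"
  using assms
proof (induction z u g arbitrary: f rule: inner_del.induct)
  case (3 z a b u g)
  have "((\<lambda>x. inner_del z (b # u) (\<lambda>v. f x (a # v))) \<longlongrightarrow> inner_del z (b # u) (\<lambda>v. g (a # v))) F"
    by (rule "3.IH") (use "3.prems" in auto)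
  then show ?case unfolding inner_del.simps by (intro tendsto_intros "3.prems") auto
qed (auto intro!: tendsto_intros)

lemma inner_del_has_vector_derivative:
  assumes "\<And>v. Suc (length v) = length u \<Longrightarrow> ((\<lambda>x. f x v) has_vector_derivative g v) F"
  shows "((\<lambda>x. inner_del z u (f x)) has_vector_derivative inner_del z u g) F"
  using assms
proof (induction z u g arbitrary: f rule: inner_del.induct)
  case (2 z a g)
  show ?case unfolding inner_del.simps
    by (intro has_vector_derivative_mult_right "2.prems") auto
next
  case (3 z a b u g)
  have "((\<lambda>x. inner_del z (b # u) (\<lambda>v. f x (a # v))) has_vector_derivative inner_del z (b # u) (\<lambda>v. g (a # v))) F"
    by (rule "3.IH") (use "3.prems" in auto)
  then show ?case unfolding inner_del.simps
    by (intro has_vector_derivative_add has_vector_derivative_mult_right has_vector_derivative_diff "3.prems") auto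
qed auto

text \<open>The candidate for the derivative of \<open>iint\<close> in \<open>z\<close>. The last
  term is the contribution of the upper end point: \<open>1 / (z - x)\<close> is the derivative of
  log (z - x) in \<open>z\<close>, and it occurs only if the outermost letter is
  \<open>Ez\<close>.\<close>

fun iint_dz :: "complex \<Rightarrow> letter list \<Rightarrow> real \<Rightarrow> complex" where
  "iint_dz z [] x = 0"
| "iint_dz z (a # u) x = inner_del z (a # u) (\<lambda>v. iint z v x)
     + of_bool (a = Ez) / (z - complex_of_real x) * iint z u x"

text \<open>The quotient rule applied to \<open>integrand\<close>, with \<open>iint_dz\<close>
  standing in for the derivative of \<open>iint\<close>, which is identified only later.\<close>

definition integrand_dz :: "complex \<Rightarrow> letter \<Rightarrow> letter list \<Rightarrow> real \<Rightarrow> complex" where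
  "integrand_dz z a u t = iint_dz z u t / (complex_of_real t - label z a)
     + of_bool (a = Ez) * iint z u t / (complex_of_real t - z)\<^sup>2"

text \<open>A bound depending only on the length, because \<open>inner_del\<close> mixes different
  words of the same length.\<close>

lemma word_wt_le:
  assumes "0 < d"
  shows "word_wt d v \<le> (2 * max 1 (1 / d)) ^ length v"
proof (induction v)
  case (Cons a v)
  have "2 * letter_wt d a \<le> 2 * max 1 (1 / d)" by (simp add: letter_wt_def)
  then have "2 * letter_wt d a * word_wt d v \<le> 2 * max 1 (1 / d) * (2 * max 1 (1 / d)) ^ length v"
    using Cons word_wt_pos[OF assms, of v] letter_wt_pos[OF assms, of a] assms
    by (intro mult_mono) auto
  then show ?case by simp
qed auto

lemma far_inverse_bound:
  assumes "far d z" "0 \<le> x" "x \<le> 1"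
  shows "norm (of_bool P / (z - complex_of_real x)) \<le> 1 / d"
proof -
  have "d \<le> norm (z - complex_of_real x)" "0 < d"
    using assms by (auto simp: far_def norm_minus_commute)
  then show ?thesis by (auto simp: norm_divide intro!: divide_left_mono mult_pos_pos elim: less_le_trans)
qed

text \<open>\<open>C\<close> depends on \<open>d\<close> and \<open>u\<close> only, as domination
  under the integral sign demands. For at least two letters all words that occur are nonempty, so
  every term is bounded by \<open>bnd\<close>. For one letter the terms are constants at 0, and only
  their difference is small.\<close>

lemma iint_dz_bound:
  assumes "0 < d"
  obtains C where "0 \<le> C" "\<And>z x. far d z \<Longrightarrow> 0 < x \<Longrightarrow> x < 1 \<Longrightarrow> norm (iint_dz z u x) \<le> C * word_bnd u x"
proof -
  consider "u = []" | a where "u = [a]" | a b w where "u = a # b # w"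
    by (metis list.exhaust)
  then show thesis
  proof cases
    case 1
    then show thesis by (intro that[of 0]) auto
  next
    case 2
    show thesis
    proof (rule that)
      show "0 \<le> 2 / d\<^sup>2" by simp
      fix z x assume z: "far d z" and x: "0 < x" "x < (1::real)"
      have n: "z \<noteq> 0" "z \<noteq> complex_of_real x"
        using far_neq[OF z, of 0] far_neq[OF z, of x] x by auto
      have g: "0 \<le> bnd x" "x \<le> 2 * bnd x" using x bnd_nonneg bnd_le by auto
      show "norm (iint_dz z u x) \<le> 2 / d\<^sup>2 * word_bnd u x"
      proof (cases "a = Ez")
        case True
        \<comment> \<open>The cancellation 1 / (z - x) - 1 / z = x / (z (z - x)) produces the zero
          at x = 0.\<close>
        have "iint_dz z u x = of_bool True / (z - complex_of_real 0) * (of_bool True / (z - complex_of_real x)) * x"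
          using n True 2 by (simp add: field_simps)
        also have "norm \<dots> \<le> 1 / d * (1 / d) * x"
          unfolding norm_mult using z x assms
          by (intro mult_mono far_inverse_bound) auto
        also have "\<dots> \<le> 1 / d * (1 / d) * (2 * bnd x)"
          using g assms by (intro mult_left_mono) auto
        finally show ?thesis using 2 by (simp add: word_bnd_def power2_eq_square)
      next
        case False
        then have "iint_dz z u x = 0" using 2 by (cases a) auto
        then show ?thesis using g 2 by (simp add: word_bnd_def)
      qed
    qed
  next
    case 3
    define M where "M = (2 * max 1 (1 / d)) ^ Suc (length w)"
    have M: "0 \<le> M" by (simp add: M_def)
    show thesis
    proof (rule that)
      show "0 \<le> (2 * real (length u) + 1) * M / d" using assms M by simp
      fix z x assume z: "far d z" and x: "0 < x" "x < (1::real)"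
      have g: "0 \<le> bnd x" using x bnd_nonneg by auto
      have *: "norm (iint z v x) \<le> M * bnd x" if "Suc (length v) = length u" for v
      proof -
        have "norm (iint z v x) \<le> word_wt d v * word_bnd v x"
          by (rule iint_bound[OF z x])
        also have "\<dots> \<le> M * bnd x"
        proof -
          have "v \<noteq> []" "length v = Suc (length w)" using that 3 by auto
          then show ?thesis
            using word_wt_le[OF assms, of v] g by (auto simp: M_def word_bnd_def intro!: mult_right_mono)
        qed
        finally show ?thesis .
      qed
      have 1: "norm (inner_del z u (\<lambda>v. iint z v x)) \<le> 2 * real (length u) * (M * bnd x) / d"
        using z * M g by (intro inner_del_bound) auto
      have 2: "norm (of_bool (a = Ez) / (z - complex_of_real x) * iint z (b # w) x) \<le> 1 / d * (M * bnd x)"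
        unfolding norm_mult using z x assms *[of "b # w"] 3 M g
        by (intro mult_mono far_inverse_bound) (auto simp del: iint.simps)
      have "norm (iint_dz z u x) \<le> 2 * real (length u) * (M * bnd x) / d + 1 / d * (M * bnd x)"
        using order_trans[OF norm_triangle_ineq add_mono[OF 1 2]] unfolding 3 iint_dz.simps .
      also have "\<dots> = (2 * real (length u) + 1) * M / d * word_bnd u x"
        using 3 assms by (simp add: word_bnd_def field_simps)
      finally show "norm (iint_dz z u x) \<le> (2 * real (length u) + 1) * M / d * word_bnd u x" .
    qed
  qed
qed

text \<open>Provides the dominating function, uniform in \<open>z\<close>, for differentiating under
  the integral sign.\<close>

lemma integrand_dz_bound:
  assumes "0 < d" "a \<noteq> E0 \<or> u \<noteq> []"
  obtains C where "\<And>z t. far d z \<Longrightarrow> 0 < t \<Longrightarrow> t < 1 \<Longrightarrow> norm (integrand_dz z a u t) \<le> C * majorant a t"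
proof -
  obtain C where C: "0 \<le> C" "\<And>z x. far d z \<Longrightarrow> 0 < x \<Longrightarrow> x < 1 \<Longrightarrow> norm (iint_dz z u x) \<le> C * word_bnd u x"
    using iint_dz_bound[OF assms(1)] by blast
  define C' where "C' = C * letter_wt d a + (word_wt d u * (1 / d)) * letter_wt d Ez"
  show thesis
  proof (rule that)
    fix z t assume z: "far d z" and t: "0 < t" "t < (1::real)"
    have 1: "norm (iint_dz z u t / (complex_of_real t - label z a)) \<le> C * letter_wt d a * majorant a t"
      by (rule letter_bound) (use z t assms C in auto)
    have 2: "norm (of_bool (a = Ez) * iint z u t / (complex_of_real t - z)\<^sup>2)
               \<le> (word_wt d u * (1 / d)) * letter_wt d Ez * majorant a t"
    proof (cases "a = Ez")
      case True
      \<comment> \<open>One factor of the square is estimated by \<open>1 / d\<close>; the other is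
        left to \<open>letter_bound\<close>, which supplies the majorant.\<close>
      have "norm (iint z u t * (of_bool True / (z - complex_of_real t))) \<le> (word_wt d u * word_bnd u t) * (1 / d)"
        unfolding norm_mult using z t iint_bound[OF z t, of u] order_trans[OF norm_ge_zero iint_bound[OF z t, of u]]
        by (intro mult_mono far_inverse_bound) auto
      then have "norm ((iint z u t * (of_bool True / (z - complex_of_real t))) / (complex_of_real t - label z Ez))
          \<le> (word_wt d u * (1 / d)) * letter_wt d Ez * majorant Ez t"
        using z t assms word_wt_pos[OF assms(1), of u] by (intro letter_bound[where u = u]) (auto simp: mult_ac)
      then show ?thesis using True by (simp add: norm_mult norm_divide norm_power power2_eq_square norm_minus_commute)
    next
      case False
      then show ?thesis
        using t word_wt_pos[OF assms(1), of u] letter_wt_pos[OF assms(1), of Ez] assms(1) by (simp add: majorant_def)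
    qed
    show "norm (integrand_dz z a u t) \<le> C' * majorant a t"
      unfolding integrand_dz_def C'_def distrib_right
      by (rule order_trans[OF norm_triangle_ineq add_mono[OF 1 2]])
  qed
qed

text \<open>The right hand side is the \<open>z\<close>-derivative of the integrand of \<open>iint z (a # u)\<close>; thus
  \<open>iint_dz\<close> satisfies the recursion in \<open>x\<close> that the \<open>z\<close>-derivative of \<open>iint\<close> has to satisfy.\<close>

lemma iint_dz_has_vector_derivative:
  assumes z: "far d z" and adm: "last (a # u) \<noteq> E0" and x: "0 < x" "x < 1"
  shows "(iint_dz z (a # u) has_vector_derivative integrand_dz z a u x) (at x)"
proof -
  have n: "z \<noteq> 0" "z \<noteq> 1" "z \<noteq> complex_of_real x" "complex_of_real x \<noteq> 0" "complex_of_real x \<noteq> 1"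
    using far_neq[OF z, of 0] far_neq[OF z, of 1] far_neq[OF z, of x] x by auto
  have r: "((\<lambda>x. of_bool P / (z - complex_of_real x)) has_vector_derivative of_bool P / (z - complex_of_real x)\<^sup>2) (at x)" for P
  proof -
    have "((\<lambda>w. of_bool P / (z - w)) has_field_derivative of_bool P / (z - complex_of_real x)\<^sup>2) (at (complex_of_real x))"
      using n by (auto intro!: derivative_eq_intros simp: power2_eq_square)
    moreover have "(complex_of_real has_vector_derivative complex_of_real 1) (at x)"
      by (rule bounded_linear.has_vector_derivative[OF bounded_linear_of_real has_vector_derivative_id])
    ultimately have "(((\<lambda>w. of_bool P / (z - w)) \<circ> complex_of_real) has_vector_derivative
                 1 * (of_bool P / (z - complex_of_real x)\<^sup>2)) (at x)"
      by (intro field_vector_diff_chain_at) auto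
    then show ?thesis by (simp add: o_def)
  qed
  show ?thesis
  proof (cases u)
    case Nil
    have "((\<lambda>x. - dlog z E0 a + of_bool (a = Ez) / (z - complex_of_real x)) has_vector_derivative
             0 + of_bool (a = Ez) / (z - complex_of_real x)\<^sup>2) (at x)"
      by (intro has_vector_derivative_add r) auto
    moreover have "iint_dz z (a # u) = (\<lambda>x. - dlog z E0 a + of_bool (a = Ez) / (z - complex_of_real x))"
      using Nil by auto
    moreover have "integrand_dz z a u x = 0 + of_bool (a = Ez) / (z - complex_of_real x)\<^sup>2"
      using Nil by (simp add: integrand_dz_def power2_commute)
    ultimately show ?thesis by simp
  next
    case (Cons b w)
    have bw: "b \<noteq> E0 \<or> w \<noteq> []" using adm Cons by auto
    note dbw = iint_deriv[OF z bw x]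
    show ?thesis
    proof (cases "a = E0 \<and> w = []")
      \<comment> \<open>Here \<open>iint z [E0]\<close> occurs with total coefficient
        \<open>dlog z b E0 - dlog z E0 b\<close>, which is 0 by symmetry, so its default value does
        no harm. The case is separate because \<open>iint_deriv\<close> does not cover this
        word.\<close>
      case True
      then have b: "b \<noteq> E0" using bw by auto
      have "((\<lambda>x. - dlog z b E0 * iint z [b] x) has_vector_derivative - dlog z b E0 * integrand z b w x) (at x)"
        using dbw True by (intro has_vector_derivative_mult_right) (auto simp del: iint.simps)
      moreover have "iint_dz z (a # u) = (\<lambda>x. - dlog z b E0 * iint z [b] x)"
        using True Cons b by (cases b) (auto simp del: iint.simps simp: iint_E0 iint_Nil)
      moreover have "integrand_dz z a u x = - dlog z b E0 * integrand z b w x"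
        using True Cons b n by (cases b) (auto simp: integrand_dz_def integrand_def field_simps)
      ultimately show ?thesis by simp
    next
      case False
      then have aw: "a \<noteq> E0 \<or> w \<noteq> []" by auto
      note daw = iint_deriv[OF z aw x]
      define P where "P = inner_del z (b # w) (\<lambda>v. iint z v x)"
      \<comment> \<open>All these words keep the outermost letter \<open>a\<close>, so
        differentiating in \<open>x\<close> strips it and leaves the common factor
        \<open>1 / (x - a)\<close>.\<close>
      have inner: "((\<lambda>x. inner_del z (b # w) (\<lambda>v. iint z (a # v) x)) has_vector_derivative
                      P / (complex_of_real x - label z a)) (at x)"
      proof -
        have "((\<lambda>x. inner_del z (b # w) (\<lambda>v. iint z (a # v) x)) has_vector_derivative
                inner_del z (b # w) (\<lambda>v. integrand z a v x)) (at x)"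
          using aw by (intro inner_del_has_vector_derivative iint_deriv[OF z _ x]) auto
        then show ?thesis by (simp only: integrand_def inner_del_divide P_def)
      qed
      have D: "iint_dz z (a # u) = (\<lambda>x. inner_del z (b # w) (\<lambda>v. iint z (a # v) x)
              + dlog z b a * (iint z (a # w) x - iint z (b # w) x)
              + of_bool (a = Ez) / (z - complex_of_real x) * iint z (b # w) x)"
        unfolding Cons by (rule ext) (simp only: iint_dz.simps inner_del.simps)
      have *: "(iint_dz z (a # u) has_vector_derivative
              P / (complex_of_real x - label z a) + dlog z b a * (integrand z a w x - integrand z b w x)
              + (of_bool (a = Ez) / (z - complex_of_real x) * integrand z b w x
                 + of_bool (a = Ez) / (z - complex_of_real x)\<^sup>2 * iint z (b # w) x)) (at x)"
        unfolding D
        by (intro has_vector_derivative_add has_vector_derivative_mult_right has_vector_derivative_diff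
              has_vector_derivative_mult inner daw dbw r)
      define q s where "q = iint z w x" and "s = iint z (b # w) x"
      have "integrand_dz z a u x = (P + of_bool (b = Ez) / (z - complex_of_real x) * q) / (complex_of_real x - label z a)
              + of_bool (a = Ez) * s / (complex_of_real x - z)\<^sup>2"
        unfolding Cons integrand_dz_def P_def q_def s_def by (simp only: iint_dz.simps)
      also have "\<dots> = P / (complex_of_real x - label z a)
              + dlog z b a * (q / (complex_of_real x - label z a) - q / (complex_of_real x - label z b))
              + (of_bool (a = Ez) / (z - complex_of_real x) * (q / (complex_of_real x - label z b))
                 + of_bool (a = Ez) / (z - complex_of_real x)\<^sup>2 * s)"
      proof -
        define e where "e = complex_of_real x - label z a"
        define g where "g = complex_of_real x - label z b"
        define \<alpha> \<beta> :: complex where "\<alpha> = of_bool (a = Ez)" and "\<beta> = of_bool (b = Ez)"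
        have eg: "e \<noteq> 0" "g \<noteq> 0" using label_neq[OF z x] by (auto simp: e_def g_def)
        \<comment> \<open>Partial fractions, to be combined with d log (a - b) times (a - b) being d
          (a - b): the coefficient of dz in the latter is \<open>\<alpha> - \<beta>\<close>.\<close>
        have "q / e - q / g = q / (e * g) * (label z a - label z b)"
          using eg by (simp add: field_simps) (simp add: e_def g_def algebra_simps)
        moreover have "dlog z b a * (label z a - label z b) = \<alpha> - \<beta>"
          using n by (cases a; cases b) (auto simp: \<alpha>_def \<beta>_def field_simps)
        ultimately have 1: "dlog z b a * (q / e - q / g) = (\<alpha> - \<beta>) * (q / (e * g))"
          by (metis mult.assoc mult.commute)
        have 2: "\<alpha> / (z - complex_of_real x) = - \<alpha> / e" "\<beta> / (z - complex_of_real x) = - \<beta> / g"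
          using n by (auto simp: \<alpha>_def \<beta>_def e_def g_def field_simps)
        show ?thesis
          unfolding e_def[symmetric] g_def[symmetric] \<alpha>_def[symmetric] \<beta>_def[symmetric] 1 2
          using eg by (simp add: field_simps power2_commute)
      qed
      finally show ?thesis using * by (simp only: integrand_def q_def s_def)
    qed
  qed
qed

section \<open>Boundary behaviour and differentiation under the integral sign\<close>

lemma iint_dz_cont:
  assumes "far d z" "u = [] \<or> last u \<noteq> E0"
  shows "continuous_on {0<..<1} (iint_dz z u)"
proof (cases u)
  case Nil
  then have "iint_dz z u = (\<lambda>x. 0)" by auto
  then show ?thesis by simp
next
  case (Cons a v)
  show ?thesis
  proof (rule continuous_at_imp_continuous_on, safe)
    fix x :: real assume "x \<in> {0<..<1}"
    then show "isCont (iint_dz z u) x"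
      unfolding Cons using iint_dz_has_vector_derivative[OF assms(1), of a v x] assms(2) Cons
      by (intro has_vector_derivative_continuous) auto
  qed
qed

lemma integrand_dz_cont:
  assumes "far d z" "u = [] \<or> last u \<noteq> E0"
  shows "continuous_on {0<..<1} (integrand_dz z a u)"
  unfolding integrand_dz_def using label_neq[OF assms(1)] label_neq[OF assms(1), of _ Ez]
  by (intro continuous_intros iint_dz_cont[OF assms] iint_cont[OF assms(1)]) auto

lemma integrand_dz_integrable:
  assumes "far d z" "last (a # u) \<noteq> E0" "0 < x" "x \<le> 1" "x < 1 \<or> a \<noteq> E1"
  shows "set_integrable lborel {0<..<x} (integrand_dz z a u)"
proof -
  have "0 < d" "a \<noteq> E0 \<or> u \<noteq> []" using assms by (auto simp: far_def)
  from integrand_dz_bound[OF this] obtain C where C: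
    "\<And>z t. far d z \<Longrightarrow> 0 < t \<Longrightarrow> t < 1 \<Longrightarrow> norm (integrand_dz z a u t) \<le> C * majorant a t" by metis
  show ?thesis
  proof (rule set_integrable_dominated)
    show "continuous_on {0<..<x} (integrand_dz z a u)"
      by (rule continuous_on_subset[OF integrand_dz_cont[OF assms(1)]]) (use assms in \<open>auto split: if_splits\<close>)
    show "set_integrable lborel {0<..<x} (\<lambda>t. C * majorant a t)"
      using majorant_integrable[OF assms(3-5)] by simp
  qed (use C assms in auto)
qed

text \<open>The starting value in the fundamental theorem below; it is 0 because \<open>bnd\<close>
  vanishes at 0.\<close>

lemma iint_dz_tendsto_0:
  assumes "far d z"
  shows "(iint_dz z (a # u) \<longlongrightarrow> 0) (at_right 0)"
proof -
  have "0 < d" using assms by (auto simp: far_def)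
  from iint_dz_bound[OF this] obtain C where C:
    "\<And>z x. far d z \<Longrightarrow> 0 < x \<Longrightarrow> x < 1 \<Longrightarrow> norm (iint_dz z (a # u) x) \<le> C * word_bnd (a # u) x" by metis
  show ?thesis
  proof (rule Lim_null_comparison)
    show "\<forall>\<^sub>F x in at_right 0. norm (iint_dz z (a # u) x) \<le> C * bnd x"
      using eventually_at_right_less[of 0] eventually_at_rightI[of 0 1 "\<lambda>x. x < (1::real)"]
      by (auto elim!: eventually_elim2 dest: C[OF assms] simp: word_bnd_def simp del: iint_dz.simps)
    have "((\<lambda>x. C * bnd x) \<longlongrightarrow> C * (1 / sqrt (1 - 0) - 1)) (at_right 0)"
      unfolding bnd_def by (intro tendsto_intros) auto
    then show "((\<lambda>x. C * bnd x) \<longlongrightarrow> 0) (at_right 0)" by simp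
  qed
qed

text \<open>If \<open>u\<close> starts with \<open>E1\<close>, then \<open>iint z u\<close> may blow up at \<open>1\<close>, but only like \<open>1 / sqrt (1 - x)\<close>,
  while its coefficient vanishes to first order.\<close>

lemma iint_dz_tendsto_1:
  assumes z: "far d z" and a: "a \<noteq> E1"
  shows "(iint_dz z (a # u) \<longlongrightarrow> iint_dz z (a # u) 1) (at_left 1)"
proof -
  have n: "z \<noteq> complex_of_real 1" using far_neq[OF z, of 1] by auto
  have r: "((\<lambda>x. of_bool P / (z - complex_of_real x)) \<longlongrightarrow> of_bool P / (z - complex_of_real 1)) (at_left 1)" for P
    using n by (intro tendsto_intros) auto
  show ?thesis
  proof (cases u)
    case Nil
    have D: "iint_dz z (a # u) = (\<lambda>x. - dlog z E0 a + of_bool (a = Ez) / (z - complex_of_real x))"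
      using Nil by auto
    show ?thesis unfolding D by (intro tendsto_add tendsto_const r)
  next
    case (Cons b w)
    \<comment> \<open>All occurrences of the word \<open>b # w\<close> are collected into one term.
      Every other word has outermost letter \<open>a\<close>, which is not \<open>E1\<close>, and
      converges at 1.\<close>
    have D: "iint_dz z (a # u) = (\<lambda>x. (inner_del z (b # w) (\<lambda>v. iint z (a # v) x) + dlog z b a * iint z (a # w) x)
              + (of_bool (a = Ez) / (z - complex_of_real x) - dlog z b a) * iint z (b # w) x)"
      unfolding Cons
      by (rule ext) (simp only: iint_dz.simps inner_del.simps, simp add: algebra_simps del: iint.simps)
    have 1: "((\<lambda>x. inner_del z (b # w) (\<lambda>v. iint z (a # v) x) + dlog z b a * iint z (a # w) x) \<longlongrightarrow>
                inner_del z (b # w) (\<lambda>v. iint z (a # v) 1) + dlog z b a * iint z (a # w) 1) (at_left 1)"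
      using a by (intro tendsto_intros inner_del_tendsto iint_tendsto_left[OF z]) auto
    have 2: "((\<lambda>x. (of_bool (a = Ez) / (z - complex_of_real x) - dlog z b a) * iint z (b # w) x) \<longlongrightarrow>
               (of_bool (a = Ez) / (z - complex_of_real 1) - dlog z b a) * iint z (b # w) 1) (at_left 1)"
    proof (cases "b = E1")
      case False
      then show ?thesis by (intro tendsto_intros r iint_tendsto_left[OF z]) auto
    next
      case True
      have dlog: "dlog z b a = of_bool (a = Ez) / (z - complex_of_real 1)"
        using True a by (cases a) auto
      have d: "0 < d" using z by (simp add: far_def)
      define C where "C = 1 / d * (1 / d) * word_wt d (b # w)"
      have "((\<lambda>x. (of_bool (a = Ez) / (z - complex_of_real x) - dlog z b a) * iint z (b # w) x) \<longlongrightarrow> 0) (at_left 1)"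
      proof (rule Lim_null_comparison)
        have *: "norm ((of_bool (a = Ez) / (z - complex_of_real x) - dlog z b a) * iint z (b # w) x) \<le> C * sqrt (1 - x)"
          if x: "0 < x" "x < 1" for x
        proof -
          have "of_bool (a = Ez) / (z - complex_of_real x) - dlog z b a
                  = of_bool (a = Ez) / (z - complex_of_real x) * (of_bool True / (z - complex_of_real 1)) * complex_of_real (x - 1)"
            using n far_neq[OF z, of x] x by (simp add: dlog field_simps)
          also have "norm \<dots> \<le> 1 / d * (1 / d) * (1 - x)"
            unfolding norm_mult using z x d by (intro mult_mono far_inverse_bound) (auto simp del: of_real_diff)
          finally have "norm ((of_bool (a = Ez) / (z - complex_of_real x) - dlog z b a) * iint z (b # w) x)
              \<le> (1 / d * (1 / d) * (1 - x)) * (word_wt d (b # w) * (1 / sqrt (1 - x)))"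
            unfolding norm_mult[of _ "iint z (b # w) x"]
          proof (rule mult_mono)
            have "norm (iint z (b # w) x) \<le> word_wt d (b # w) * bnd x"
              using iint_bound[OF z x, of "b # w"] by (simp add: word_bnd_def del: iint.simps)
            also have "\<dots> \<le> word_wt d (b # w) * (1 / sqrt (1 - x))"
              using bnd_le(3)[OF x] word_wt_pos[OF d, of "b # w"] by (intro mult_left_mono) auto
            finally show "norm (iint z (b # w) x) \<le> word_wt d (b # w) * (1 / sqrt (1 - x))" .
          qed (use d x in auto)
          also have "\<dots> = C * ((1 - x) / sqrt (1 - x))" by (simp add: C_def)
          also have "(1 - x) / sqrt (1 - x) = sqrt (1 - x)"
            using x by (simp add: real_div_sqrt)
          finally show ?thesis .
        qed
        show "\<forall>\<^sub>F x in at_left 1. norm ((of_bool (a = Ez) / (z - complex_of_real x) - dlog z b a) * iint z (b # w) x)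
                \<le> C * sqrt (1 - x)"
          by (rule eventually_at_leftI[of 0]) (use * in \<open>auto simp del: iint.simps\<close>)
        have "((\<lambda>x. C * sqrt (1 - x)) \<longlongrightarrow> C * sqrt (1 - 1)) (at_left 1)"
          by (intro tendsto_intros)
        then show "((\<lambda>x. C * sqrt (1 - x)) \<longlongrightarrow> 0) (at_left 1)" by simp
      qed
      \<comment> \<open>The limit to be shown is 0 as well: its coefficient vanishes, whatever value
        \<open>iint z (b # w) 1\<close> has.\<close>
      then show ?thesis using dlog by simp
    qed
    show ?thesis unfolding D by (rule tendsto_add[OF 1 2])
  qed
qed

text \<open>The fundamental theorem on the open interval with primitive \<open>iint_dz\<close>,
  whose limits at both ends have been determined. This makes \<open>iint_dz\<close> satisfy the same
  integral recursion as the derivative of \<open>iint\<close>, including the case x = 1.\<close>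

lemma integral_integrand_dz:
  assumes z: "far d z" and adm: "last (a # u) \<noteq> E0" and x: "0 < x" "x \<le> 1" "x < 1 \<or> a \<noteq> E1"
  shows "(LINT t:{0<..<x}|lborel. integrand_dz z a u t) = iint_dz z (a # u) x"
proof -
  have u: "u = [] \<or> last u \<noteq> E0" using adm by auto
  have "(LBINT t=0..x. integrand_dz z a u t) = iint_dz z (a # u) x - 0"
  proof (rule interval_integral_FTC_integrable)
    show "0 < ereal x" using x by simp
    show "(iint_dz z (a # u) has_vector_derivative integrand_dz z a u t) (at t)"
      if "0 < ereal t" "ereal t < ereal x" for t
      using that x by (intro iint_dz_has_vector_derivative[OF z adm]) auto
    show "isCont (integrand_dz z a u) t" if "0 < ereal t" "ereal t < ereal x" for t
      using that x integrand_dz_cont[OF z u] by (auto simp: continuous_on_eq_continuous_at)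
    show "set_integrable lborel (einterval 0 (ereal x)) (integrand_dz z a u)"
      using integrand_dz_integrable[OF z adm x] by (simp add: zero_ereal_def)
    show "((iint_dz z (a # u) \<circ> real_of_ereal) \<longlongrightarrow> 0) (at_right 0)"
      using iint_dz_tendsto_0[OF z, of a u] by (simp only: zero_ereal_def ereal_tendsto_simps)
    have "(iint_dz z (a # u) \<longlongrightarrow> iint_dz z (a # u) x) (at_left x)"
    proof (cases "x = 1")
      case True
      then show ?thesis using iint_dz_tendsto_1[OF z] x by auto
    next
      case False
      then have "isCont (iint_dz z (a # u)) x"
        using iint_dz_has_vector_derivative[OF z adm, of x] x by (intro has_vector_derivative_continuous) auto
      then show ?thesis by (simp add: isCont_def filterlim_at_split del: iint_dz.simps)
    qed
    then show "((iint_dz z (a # u) \<circ> real_of_ereal) \<longlongrightarrow> iint_dz z (a # u) x) (at_left (ereal x))"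
      by (simp only: ereal_tendsto_simps)
  qed
  then show ?thesis using x by (simp add: interval_integral_Ioo zero_ereal_def del: iint_dz.simps)
qed

text \<open>Induction on the word: differentiate under the outermost integral and evaluate the
  result by \<open>integral_integrand_dz\<close>. Domination on a ball around \<open>z\<close>
  halves the distance, so \<open>d\<close> and \<open>z\<close> have to vary in the
  induction.\<close>

theorem iint_has_field_derivative:
  assumes "far d z" "u = [] \<or> last u \<noteq> E0" "0 < x" "x \<le> 1" "x < 1 \<or> u = [] \<or> hd u \<noteq> E1"
  shows "((\<lambda>z. iint z u x) has_field_derivative iint_dz z u x) (at z)"
  using assms
proof (induction u arbitrary: d z x)
  case Nil
  then show ?case by simp
next
  case (Cons a u)
  note z = Cons.prems(1)
  have adm: "last (a # u) \<noteq> E0" and u: "u = [] \<or> last u \<noteq> E0" and au: "a \<noteq> E0 \<or> u \<noteq> []"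
    and x: "0 < x" "x \<le> 1" "x < 1 \<or> a \<noteq> E1"
    using Cons.prems by auto
  have d: "0 < d" using z by (simp add: far_def)
  then have "0 < d / 2" by simp
  from integrand_dz_bound[OF this au] obtain C where C:
    "\<And>z t. far (d/2) z \<Longrightarrow> 0 < t \<Longrightarrow> t < 1 \<Longrightarrow> norm (integrand_dz z a u t) \<le> C * majorant a t"
    by metis
  have "((\<lambda>\<zeta>. LINT t|lborel. indicator {0<..<x} t *\<^sub>R integrand \<zeta> a u t) has_field_derivative
          (LINT t|lborel. indicator {0<..<x} t *\<^sub>R integrand_dz z a u t)) (at z)"
  proof (rule has_field_derivative_integral_dominated)
    show "0 < d / 2" using d by simp
    fix \<zeta> assume "\<zeta> \<in> ball z (d / 2)"
    then have \<zeta>: "far (d / 2) \<zeta>" using far_ball[OF z] by blast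
    show "integrable lborel (\<lambda>t. indicator {0<..<x} t *\<^sub>R integrand \<zeta> a u t)"
      using integrand_integrable[OF \<zeta> au x] by (simp add: set_integrable_def)
    fix t :: real
    show "((\<lambda>\<zeta>. indicator {0<..<x} t *\<^sub>R integrand \<zeta> a u t) has_field_derivative
             indicator {0<..<x} t *\<^sub>R integrand_dz \<zeta> a u t) (at \<zeta>)"
    proof (cases "t \<in> {0<..<x}")
      case True
      then have t: "0 < t" "t < 1" using x by auto
      \<comment> \<open>Inside the interval t < 1, so the induction hypothesis applies even if the
        outermost letter of \<open>u\<close> is \<open>E1\<close>.\<close>
      have ih: "((\<lambda>z. iint z u t) has_field_derivative iint_dz \<zeta> u t) (at \<zeta>)"
        using Cons.IH[OF \<zeta> u] t by simp
      have ne: "complex_of_real t \<noteq> label \<zeta> a" by (rule label_neq[OF \<zeta> t])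
      have "((\<lambda>z. label z a) has_field_derivative of_bool (a = Ez)) (at \<zeta>)"
        by (cases a) auto
      with ih have "((\<lambda>z. iint z u t / (complex_of_real t - label z a)) has_field_derivative
             (iint_dz \<zeta> u t * (complex_of_real t - label \<zeta> a) - iint \<zeta> u t * (0 - of_bool (a = Ez))) /
               ((complex_of_real t - label \<zeta> a) * (complex_of_real t - label \<zeta> a))) (at \<zeta>)"
        using ne by (intro DERIV_divide DERIV_diff DERIV_const) auto
      also have "(iint_dz \<zeta> u t * (complex_of_real t - label \<zeta> a) - iint \<zeta> u t * (0 - of_bool (a = Ez))) /
               ((complex_of_real t - label \<zeta> a) * (complex_of_real t - label \<zeta> a)) = integrand_dz \<zeta> a u t"
      proof -
        have "(D * e - s * (0 - b)) / (e * e) = D / e + b * s / e\<^sup>2" if "e \<noteq> 0" for D e s b :: complex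
          using that by (simp add: field_simps power2_eq_square)
        from this[of "complex_of_real t - label \<zeta> a" "iint_dz \<zeta> u t" "iint \<zeta> u t" "of_bool (a = Ez)"]
        show ?thesis using ne unfolding integrand_dz_def by (cases a) auto
      qed
      finally show ?thesis using True by (simp add: integrand_def)
    qed simp
    show "norm (indicator {0<..<x} t *\<^sub>R integrand_dz \<zeta> a u t) \<le> indicator {0<..<x} t *\<^sub>R (C * majorant a t)"
      using C[OF \<zeta>, of t] x by (auto simp: indicator_def)
  next
    show "integrable lborel (\<lambda>t. indicator {0<..<x} t *\<^sub>R (C * majorant a t))"
      using majorant_integrable[OF x, THEN set_integrable_mult_right, of C] by (simp only: set_integrable_def)
    show "(\<lambda>t. indicator {0<..<x} t *\<^sub>R integrand_dz z a u t) \<in> borel_measurable lborel"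
      using integrand_dz_integrable[OF z adm x] by (auto simp: set_integrable_def)
  qed
  then show ?case
    unfolding iint_Cons[OF au] integral_integrand_dz[OF z adm x, symmetric] set_lebesgue_integral_def .
qed

section \<open>Reduction of the simplex integral to iterated integrals\<close>

text \<open>The domain \<open>simplex_dom\<close> with a variable upper bound: fixing the largest
  variable leaves a simplex of one dimension less, bounded by that variable.\<close>

definition simplex_below :: "nat \<Rightarrow> real \<Rightarrow> (nat \<Rightarrow> real) set" where
  "simplex_below m x = {t \<in> space (Pi\<^sub>M {..<m} (\<lambda>_. lborel)).
     (\<forall>i<m. 0 < t i \<and> t i < x) \<and> (\<forall>i j. i < j \<and> j < m \<longrightarrow> t i < t j)}"

lemma sets_simplex_below [measurable]: "simplex_below m x \<in> sets (Pi\<^sub>M {..<m} (\<lambda>_. lborel))"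
proof -
  have "simplex_below m x = {t \<in> space (Pi\<^sub>M {..<m} (\<lambda>_. lborel)).
     (\<forall>i\<in>{..<m}. 0 < t i \<and> t i < x) \<and> (\<forall>j\<in>{..<m}. \<forall>i\<in>{..<j}. t i < t j)}"
    by (auto simp: simplex_below_def)
  also have "\<dots> \<in> sets (Pi\<^sub>M {..<m} (\<lambda>_. lborel))"
  proof -
    have [measurable]: "(\<lambda>t. t i) \<in> borel_measurable (Pi\<^sub>M {..<m} (\<lambda>_. lborel))" if "i < m" for i
      using measurable_component_singleton[of i "{..<m}" "\<lambda>_. lborel"] that by simp
    show ?thesis
      by (intro sets.sets_Collect_conj sets.sets_Collect_finite_All' predE pred_intros_finite borel_measurable_pred_less) auto
  qed
  finally show ?thesis .
qed

text \<open>The reversal attaches the head of \<open>u\<close> to the largest variable, which has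
  the highest index. Adding an outer letter thus leaves the lower coordinates and their letters in
  place.\<close>

definition word_integrand :: "complex \<Rightarrow> letter list \<Rightarrow> real \<Rightarrow> (nat \<Rightarrow> real) \<Rightarrow> complex" where
  "word_integrand z u x t = indicator (simplex_below (length u) x) t *\<^sub>R
     (\<Prod>i<length u. 1 / (complex_of_real (t i) - label z (rev u ! i)))"

lemma word_integrand_measurable [measurable]:
  "word_integrand z u x \<in> borel_measurable (Pi\<^sub>M {..<length u} (\<lambda>_. lborel))"
proof -
  have [measurable]: "(\<lambda>t. t i) \<in> borel_measurable (Pi\<^sub>M {..<length u} (\<lambda>_. lborel))" if "i < length u" for i
    using measurable_component_singleton[of i "{..<length u}" "\<lambda>_. lborel"] that by simp
  have "(\<lambda>t. \<Prod>i<length u. 1 / (complex_of_real (t i) - label z (rev u ! i)))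
          \<in> borel_measurable (Pi\<^sub>M {..<length u} (\<lambda>_. lborel))"
    by (intro borel_measurable_prod) (auto intro!: borel_measurable_divide borel_measurable_diff borel_measurable_of_real)
  then show ?thesis unfolding word_integrand_def by measurable
qed

lemma fun_upd_mem_simplex_below:
  assumes "t \<in> space (Pi\<^sub>M {..<m} (\<lambda>_. lborel))"
  shows "t(m := y) \<in> simplex_below (Suc m) x \<longleftrightarrow> 0 < y \<and> y < x \<and> t \<in> simplex_below m y"
proof
  assume L: "t(m := y) \<in> simplex_below (Suc m) x"
  have A: "0 < (t(m := y)) i \<and> (t(m := y)) i < x" if "i < Suc m" for i
    using L that unfolding simplex_below_def by blast
  have B: "(t(m := y)) i < (t(m := y)) j" if "i < j" "j < Suc m" for i j
    using L that unfolding simplex_below_def by blast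
  have "t i < y" if "i < m" for i
    using B[of i m] that by simp
  moreover have "0 < t i" if "i < m" for i
    using A[of i] that by simp
  moreover have "t i < t j" if "i < j" "j < m" for i j
    using B[of i j] that by simp
  moreover have "0 < y" "y < x"
    using A[of m] by auto
  ultimately show "0 < y \<and> y < x \<and> t \<in> simplex_below m y"
    using assms by (auto simp: simplex_below_def)
next
  assume "0 < y \<and> y < x \<and> t \<in> simplex_below m y"
  then show "t(m := y) \<in> simplex_below (Suc m) x"
    using assms by (fastforce simp: simplex_below_def space_PiM less_Suc_eq PiE_def extensional_def)
qed

lemma word_integrand_Cons:
  assumes "t \<in> space (Pi\<^sub>M {..<length u} (\<lambda>_. lborel))"
  shows "word_integrand z (a # u) x (t(length u := y)) =
           indicator {0<..<x} y *\<^sub>R (word_integrand z u y t / (complex_of_real y - label z a))"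
proof -
  have "(\<Prod>i<length u. 1 / (complex_of_real ((t(length u := y)) i) - label z ((rev u @ [a]) ! i)))
      = (\<Prod>i<length u. 1 / (complex_of_real (t i) - label z (rev u ! i)))"
    by (rule prod.cong) (auto simp: nth_append)
  moreover have "(rev u @ [a]) ! length u = a" by (simp add: nth_append)
  ultimately show ?thesis
    using fun_upd_mem_simplex_below[OF assms, of y x]
    by (auto simp: word_integrand_def indicator_def)
qed

text \<open>Tonelli with the highest coordinate as outer variable. The bound for \<open>u\<close> is
  taken as a hypothesis so that the same step serves both in the induction for x < 1 and once more
  at x = 1.\<close>

lemma nn_integral_word_integrand_Cons:
  assumes z: "far d z" and au: "a \<noteq> E0 \<or> u \<noteq> []" and x: "0 < x" "x \<le> 1" "x < 1 \<or> a \<noteq> E1"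
    and IH: "\<And>y. 0 < y \<Longrightarrow> y < 1 \<Longrightarrow>
      (\<integral>\<^sup>+t. norm (word_integrand z u y t) \<partial>Pi\<^sub>M {..<length u} (\<lambda>_. lborel)) \<le> ennreal (word_wt d u * word_bnd u y)"
  shows "(\<integral>\<^sup>+t. norm (word_integrand z (a # u) x t) \<partial>Pi\<^sub>M {..<length (a # u)} (\<lambda>_. lborel))
     \<le> ennreal (word_wt d u * letter_wt d a * (LINT t:{0<..<x}|lborel. majorant a t))"
proof -
  interpret product_sigma_finite "\<lambda>_::nat. lborel :: real measure"
    by (simp add: product_sigma_finite_def lborel.sigma_finite_measure_axioms)
  define c where "c = word_wt d u * letter_wt d a"
  have d: "0 < d" using z by (simp add: far_def)
  have c: "0 \<le> c" using word_wt_pos[OF d, of u] letter_wt_pos[OF d, of a] by (simp add: c_def)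
  have maj: "0 \<le> majorant a y" if "y < 1" for y using that by (simp add: majorant_def)
  have i: "integrable lborel (\<lambda>y. indicator {0<..<x} y * (c * majorant a y))"
    using majorant_integrable[OF x, THEN set_integrable_mult_right, of c] by (simp add: set_integrable_def)
  have "(\<integral>\<^sup>+t. norm (word_integrand z (a # u) x t) \<partial>Pi\<^sub>M {..<length (a # u)} (\<lambda>_. lborel))
    = (\<integral>\<^sup>+t. norm (word_integrand z (a # u) x t) \<partial>Pi\<^sub>M (insert (length u) {..<length u}) (\<lambda>_. lborel))"
    by (simp add: lessThan_Suc)
  also have "\<dots> = (\<integral>\<^sup>+y. \<integral>\<^sup>+t. norm (word_integrand z (a # u) x (t(length u := y)))
                \<partial>Pi\<^sub>M {..<length u} (\<lambda>_. lborel) \<partial>lborel)"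
    using word_integrand_measurable[of z "a # u" x]
    by (intro product_nn_integral_insert_rev) (auto simp: lessThan_Suc)
  also have "\<dots> \<le> (\<integral>\<^sup>+y. ennreal (indicator {0<..<x} y * (c * majorant a y)) \<partial>lborel)"
  proof (rule nn_integral_mono)
    fix y :: real
    show "(\<integral>\<^sup>+t. norm (word_integrand z (a # u) x (t(length u := y))) \<partial>Pi\<^sub>M {..<length u} (\<lambda>_. lborel))
            \<le> ennreal (indicator {0<..<x} y * (c * majorant a y))"
    proof (cases "y \<in> {0<..<x}")
      case False
      then have "(\<integral>\<^sup>+t. norm (word_integrand z (a # u) x (t(length u := y))) \<partial>Pi\<^sub>M {..<length u} (\<lambda>_. lborel))
              = (\<integral>\<^sup>+t. 0 \<partial>Pi\<^sub>M {..<length u} (\<lambda>_. lborel :: real measure))"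
        by (intro nn_integral_cong) (simp add: word_integrand_Cons)
      then show ?thesis by simp
    next
      case True
      then have y: "0 < y" "y < 1" using x by auto
      have pg: "0 \<le> word_bnd u y" using y bnd_nonneg by (simp add: word_bnd_def)
      have "(\<integral>\<^sup>+t. norm (word_integrand z (a # u) x (t(length u := y))) \<partial>Pi\<^sub>M {..<length u} (\<lambda>_. lborel))
            = (\<integral>\<^sup>+t. ennreal (1 / norm (complex_of_real y - label z a)) * norm (word_integrand z u y t) \<partial>Pi\<^sub>M {..<length u} (\<lambda>_. lborel))"
        using True
        by (intro nn_integral_cong) (simp add: word_integrand_Cons norm_divide flip: ennreal_mult)
      also have "\<dots> = ennreal (1 / norm (complex_of_real y - label z a))
            * (\<integral>\<^sup>+t. norm (word_integrand z u y t) \<partial>Pi\<^sub>M {..<length u} (\<lambda>_. lborel))"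
        by (intro nn_integral_cmult) measurable
      also have "\<dots> \<le> ennreal (1 / norm (complex_of_real y - label z a)) * ennreal (word_wt d u * word_bnd u y)"
        by (intro mult_left_mono IH y) auto
      \<comment> \<open>Writing the bound as the norm of a complex quotient gives it the form to
        which \<open>letter_bound\<close> applies.\<close>
      also have "\<dots> = ennreal (norm (complex_of_real (word_wt d u * word_bnd u y) / (complex_of_real y - label z a)))"
        using pg word_wt_pos[OF d, of u]
        by (simp add: norm_divide norm_mult flip: ennreal_mult)
      also have "\<dots> \<le> ennreal (c * majorant a y)"
        unfolding c_def
        by (intro ennreal_leI letter_bound)
           (use z y au pg word_wt_pos[OF d, of u] in \<open>auto simp: norm_mult\<close>)
      finally show ?thesis using True by simp
    qed
  qed
  also have "\<dots> = ennreal (LINT y|lborel. indicator {0<..<x} y * (c * majorant a y))"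
    using i c maj x by (intro nn_integral_eq_integral) (auto simp: indicator_def)
  also have "(LINT y|lborel. indicator {0<..<x} y * (c * majorant a y)) = (LINT y:{0<..<x}|lborel. c * majorant a y)"
    by (simp only: set_lebesgue_integral_def real_scaleR_def)
  also have "\<dots> = c * (LINT y:{0<..<x}|lborel. majorant a y)" by simp
  finally show ?thesis by (simp add: c_def)
qed

lemma nn_integral_word_integrand:
  assumes "far d z" "u = [] \<or> last u \<noteq> E0" "0 < x" "x < 1"
  shows "(\<integral>\<^sup>+t. norm (word_integrand z u x t) \<partial>Pi\<^sub>M {..<length u} (\<lambda>_. lborel)) \<le> ennreal (word_wt d u * word_bnd u x)"
  using assms(2-)
proof (induction u arbitrary: x)
  case Nil
  have "simplex_below 0 x = {\<lambda>_. undefined}" by (auto simp: simplex_below_def space_PiM)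
  then show ?case
    by (simp add: word_integrand_def PiM_empty word_bnd_def nn_integral_count_space_finite)
next
  case (Cons a u)
  have d: "0 < d" using assms by (simp add: far_def)
  have "(\<integral>\<^sup>+t. norm (word_integrand z (a # u) x t) \<partial>Pi\<^sub>M {..<length (a # u)} (\<lambda>_. lborel))
     \<le> ennreal (word_wt d u * letter_wt d a * (LINT t:{0<..<x}|lborel. majorant a t))"
    by (rule nn_integral_word_integrand_Cons[OF assms(1)]) (use Cons in \<open>auto split: if_splits\<close>)
  also have "\<dots> \<le> ennreal (word_wt d u * letter_wt d a * (2 * bnd x))"
    using Cons.prems word_wt_pos[OF d, of u] letter_wt_pos[OF d, of a]
    by (intro ennreal_leI mult_left_mono majorant_integral) auto
  finally show ?case by (simp add: word_bnd_def mult_ac)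
qed

lemma integrable_word_integrand:
  assumes z: "far d z" and "u = [] \<or> last u \<noteq> E0" and x: "0 < x" "x \<le> 1" "x < 1 \<or> u = [] \<or> hd u \<noteq> E1"
  shows "integrable (Pi\<^sub>M {..<length u} (\<lambda>_. lborel)) (word_integrand z u x)"
proof (rule integrableI_bounded)
  show "(\<integral>\<^sup>+t. norm (word_integrand z u x t) \<partial>Pi\<^sub>M {..<length u} (\<lambda>_. lborel)) < \<infinity>"
  proof (cases u)
    case Nil
    have "simplex_below 0 x = {\<lambda>_. undefined}" by (auto simp: simplex_below_def space_PiM)
    then show ?thesis
      using Nil by (simp add: word_integrand_def PiM_empty nn_integral_count_space_finite)
  next
    case (Cons a v)
    have "(\<integral>\<^sup>+t. norm (word_integrand z (a # v) x t) \<partial>Pi\<^sub>M {..<length (a # v)} (\<lambda>_. lborel))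
       \<le> ennreal (word_wt d v * letter_wt d a * (LINT t:{0<..<x}|lborel. majorant a t))"
      by (rule nn_integral_word_integrand_Cons[OF z])
         (use Cons assms nn_integral_word_integrand[OF z, of v] in \<open>auto split: if_splits\<close>)
    then show ?thesis unfolding Cons by (rule le_less_trans) simp
  qed
qed measurable

text \<open>Fubini, justified by \<open>integrable_word_integrand\<close>, splits off the highest
  coordinate, which is the variable of the outermost integration.\<close>

lemma integral_word_integrand:
  assumes z: "far d z" and "u = [] \<or> last u \<noteq> E0" "0 < x" "x \<le> 1" "x < 1 \<or> u = [] \<or> hd u \<noteq> E1"
  shows "(LINT t|Pi\<^sub>M {..<length u} (\<lambda>_. lborel). word_integrand z u x t) = iint z u x"
  using assms(2-)
proof (induction u arbitrary: x)
  case Nil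
  have "simplex_below 0 x = {\<lambda>_. undefined}" by (auto simp: simplex_below_def space_PiM)
  then show ?case
    by (simp add: word_integrand_def PiM_empty lebesgue_integral_count_space_finite)
next
  case (Cons a u)
  interpret product_sigma_finite "\<lambda>_::nat. lborel :: real measure"
    by (simp add: product_sigma_finite_def lborel.sigma_finite_measure_axioms)
  let ?n = "length u"
  let ?P = "Pi\<^sub>M {..<?n} (\<lambda>_. lborel :: real measure)"
  have au: "a \<noteq> E0 \<or> u \<noteq> []" using Cons.prems by auto
  have ins: "{..<length (a # u)} = {?n} \<union> {..<?n}" by auto
  let ?g = "\<lambda>y. indicator {0<..<x} y *\<^sub>R integrand z a u y"
  have gm: "?g \<in> borel_measurable lborel"
    using integrand_integrable[OF z au, of x] Cons.prems by (auto simp: set_integrable_def)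
  have "(LINT t|Pi\<^sub>M {..<length (a # u)} (\<lambda>_. lborel). word_integrand z (a # u) x t)
      = (LINT s|Pi\<^sub>M {?n} (\<lambda>_. lborel). LINT t|?P. word_integrand z (a # u) x (merge {?n} {..<?n} (s, t)))"
    unfolding ins
    by (rule product_integral_fold)
       (use integrable_word_integrand[OF z, of "a # u" x] Cons.prems ins in auto)
  also have "\<dots> = (LINT s|Pi\<^sub>M {?n} (\<lambda>_. lborel). ?g (s ?n))"
  proof (rule Bochner_Integration.integral_cong[OF refl])
    fix s :: "nat \<Rightarrow> real"
    have "(LINT t|?P. word_integrand z (a # u) x (merge {?n} {..<?n} (s, t)))
        = (LINT t|?P. (indicator {0<..<x} (s ?n) / (complex_of_real (s ?n) - label z a)) * word_integrand z u (s ?n) t)"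
    proof (rule Bochner_Integration.integral_cong[OF refl])
      fix t assume t: "t \<in> space ?P"
      then have "merge {?n} {..<?n} (s, t) = t(?n := s ?n)"
        by (auto simp: merge_def space_PiM PiE_def extensional_def fun_eq_iff)
      then show "word_integrand z (a # u) x (merge {?n} {..<?n} (s, t))
          = (indicator {0<..<x} (s ?n) / (complex_of_real (s ?n) - label z a)) * word_integrand z u (s ?n) t"
        by (simp add: word_integrand_Cons[OF t] indicator_def)
    qed
    also have "\<dots> = indicator {0<..<x} (s ?n) / (complex_of_real (s ?n) - label z a) * (LINT t|?P. word_integrand z u (s ?n) t)"
      by simp
    \<comment> \<open>Off the interval both sides are 0. On it the coordinate is smaller than
      \<open>x\<close>, hence smaller than 1, so the induction hypothesis applies even when x =
      1.\<close>
    also have "\<dots> = ?g (s ?n)"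
      using Cons.IH[of "s ?n"] Cons.prems by (auto simp: indicator_def integrand_def split: if_splits)
    finally show "(LINT t|?P. word_integrand z (a # u) x (merge {?n} {..<?n} (s, t))) = ?g (s ?n)" .
  qed
  also have "\<dots> = (LINT y|lborel. ?g y)"
    by (rule product_integral_singleton) (use gm in simp)
  also have "\<dots> = iint z (a # u) x"
    unfolding iint_Cons[OF au] set_lebesgue_integral_def ..
  finally show ?case .
qed

lemma L_word_eq_iint:
  assumes "far d z" "as = [] \<or> hd as \<noteq> E0 \<and> last as \<noteq> E1"
  shows "L_word z as = iint z (rev as) 1"
proof -
  have "simplex_dom (length as) = simplex_below (length (rev as)) 1"
    by (simp add: simplex_dom_def simplex_below_def)
  then have "L_word z as = (LINT t|Pi\<^sub>M {..<length (rev as)} (\<lambda>_. lborel). word_integrand z (rev as) 1 t)"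
    unfolding L_word_def set_lebesgue_integral_def word_integrand_def by simp
  also have "\<dots> = iint z (rev as) 1"
    by (rule integral_word_integrand[OF assms(1)]) (use assms(2) in \<open>auto simp: hd_rev last_rev\<close>)
  finally show ?thesis .
qed

section \<open>Linear extension and induction on word length\<close>

lemma lookup_of_int_mult:
  "Poly_Mapping.lookup (of_int k * (w :: Az)) u = k * Poly_Mapping.lookup w u"
  by (induction k rule: int_induct[where k = 0])
     (simp_all add: distrib_right left_diff_distrib lookup_add lookup_minus)

lemma keys_of_int_mult: "Poly_Mapping.keys (of_int k * (w :: Az)) \<subseteq> Poly_Mapping.keys w"
  by (auto simp: in_keys_iff lookup_of_int_mult)

lemma lin_ext_superset:
  assumes "finite S" "Poly_Mapping.keys w \<subseteq> S"
  shows "lin_ext f w = (\<Sum>u\<in>S. of_int (Poly_Mapping.lookup w u) * f (letters u))"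
  unfolding lin_ext_def using assms by (intro sum.mono_neutral_left) (auto simp: in_keys_iff)

lemma lin_ext_0 [simp]: "lin_ext f 0 = 0"
  by (simp add: lin_ext_def)

lemma lin_ext_add: "lin_ext f (v + w) = lin_ext f v + lin_ext f w"
proof -
  let ?S = "Poly_Mapping.keys v \<union> Poly_Mapping.keys w"
  have "lin_ext f x = (\<Sum>u\<in>?S. of_int (Poly_Mapping.lookup x u) * f (letters u))"
    if "x \<in> {v, w, v + w}" for x
    using that keys_add[of v w] by (intro lin_ext_superset) auto
  then show ?thesis
    by (simp add: lookup_add distrib_right sum.distrib)
qed

lemma lin_ext_sum: "lin_ext f (\<Sum>i\<in>I. g i) = (\<Sum>i\<in>I. lin_ext f (g i))"
  by (induction I rule: infinite_finite_induct) (simp_all add: lin_ext_add)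

lemma lin_ext_of_int_mult: "lin_ext f (of_int k * w) = of_int k * lin_ext f w"
proof -
  have "lin_ext f (of_int k * w) =
     (\<Sum>u\<in>Poly_Mapping.keys w. of_int (Poly_Mapping.lookup (of_int k * w) u) * f (letters u))"
    by (rule lin_ext_superset) (auto simp: keys_of_int_mult)
  then show ?thesis
    by (simp add: lookup_of_int_mult lin_ext_def sum_distrib_left mult.assoc)
qed

lemma lin_ext_word_mon [simp]: "lin_ext f (word_mon as) = f as"
  by (simp add: lin_ext_def word_mon_def)

lemma lin_ext_lin_ext: "lin_ext g (lin_ext F w) = lin_ext (\<lambda>as. lin_ext g (F as)) w"
  unfolding lin_ext_def[of F] lin_ext_def[of "\<lambda>as. lin_ext g (F as)"]
  by (simp add: lin_ext_sum lin_ext_of_int_mult)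

lemma keys_lin_ext:
  fixes F :: "letter list \<Rightarrow> Az"
  shows "Poly_Mapping.keys (lin_ext F w) \<subseteq> (\<Union>u\<in>Poly_Mapping.keys w. Poly_Mapping.keys (F (letters u)))"
  unfolding lin_ext_def by (rule order_trans[OF keys_sum]) (use keys_of_int_mult in blast)

section \<open>Admissible words and the operators \<open>del\<close>\<close>

definition admissible :: "letter list \<Rightarrow> bool" where
  "admissible as \<longleftrightarrow> as = [] \<or> hd as \<noteq> E0 \<and> last as \<noteq> E1"

lemma keys_of_int: "Poly_Mapping.keys (of_int k :: Az) \<subseteq> {0}"
  using keys_of_int_mult[of k 1] by simp

text \<open>Membership in \<open>Az0\<close> is used only through its support. For a one-letter word
  admissibility leaves just \<open>Ez\<close>, in agreement with the summand of \<open>Az0\<close>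
  generated by \<open>Ez\<close>.\<close>

lemma admissible_Az0:
  assumes "w \<in> Az0" "u \<in> Poly_Mapping.keys w"
  shows "admissible (letters u)"
proof -
  obtain m n v where w: "w = of_int m + of_int n * gen Ez
            + (\<Sum>a\<in>{E1, Ez}. \<Sum>b\<in>{E0, Ez}. gen a * v a b * gen b)"
    using assms(1) by (auto simp: Az0_def)
  have g: "Poly_Mapping.keys (gen a) = {Word [a]}" for a
    by (simp add: gen_def word_mon_def)
  have k: "\<exists>x. u = Word ([a] @ x @ [b])" if u: "u \<in> Poly_Mapping.keys (gen a * v a b * gen b)" for a b
  proof -
    obtain p q where "u = p + q" "p \<in> Poly_Mapping.keys (gen a * v a b)" "q = Word [b]"
      using subsetD[OF keys_mult u] by (auto simp: g)
    moreover from this(2) obtain r where "p = Word [a] + r"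
      using subsetD[OF keys_mult, of p "gen a" "v a b"] by (auto simp: g)
    ultimately show ?thesis by (auto simp: plus_word_def)
  qed
  consider "u \<in> Poly_Mapping.keys (of_int m :: Az)" | "u \<in> Poly_Mapping.keys (of_int n * gen Ez)"
    | "u \<in> Poly_Mapping.keys (\<Sum>a\<in>{E1, Ez}. \<Sum>b\<in>{E0, Ez}. gen a * v a b * gen b)"
  proof -
    have "u \<in> Poly_Mapping.keys (of_int m + of_int n * gen Ez)
        \<union> Poly_Mapping.keys (\<Sum>a\<in>{E1, Ez}. \<Sum>b\<in>{E0, Ez}. gen a * v a b * gen b)"
      using assms(2) unfolding w by (rule subsetD[OF keys_add])
    moreover have "Poly_Mapping.keys (of_int m + of_int n * gen Ez)
        \<subseteq> Poly_Mapping.keys (of_int m :: Az) \<union> Poly_Mapping.keys (of_int n * gen Ez)"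
      by (rule keys_add)
    ultimately show thesis using that by (auto simp del: sum.insert)
  qed
  then show ?thesis
  proof cases
    case 1
    then show ?thesis using keys_of_int[of m] by (auto simp: zero_word_def admissible_def)
  next
    case 2
    then show ?thesis using keys_of_int_mult[of n "gen Ez"] g by (auto simp: admissible_def)
  next
    case 3
    then obtain a where a: "a \<in> {E1, Ez}" "u \<in> Poly_Mapping.keys (\<Sum>b\<in>{E0, Ez}. gen a * v a b * gen b)"
      by (blast dest: subsetD[OF keys_sum])
    then obtain b where ab: "a \<in> {E1, Ez}" "b \<in> {E0, Ez}" "u \<in> Poly_Mapping.keys (gen a * v a b * gen b)"
      by (blast dest: subsetD[OF keys_sum])
    from k[OF ab(3)] ab(1,2) show ?thesis by (auto simp: admissible_def)
  qed
qed

text \<open>Indices start at 0 here: prepending \<open>E0\<close> shifts the list by one, so entry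
  \<open>i\<close> of \<open>E0 # as\<close> is the left neighbour of \<open>as ! i\<close>, and the
  appended \<open>E1\<close> is the right neighbour of the last letter.\<close>

definition del_coeff :: "letter \<Rightarrow> letter list \<Rightarrow> nat \<Rightarrow> int" where
  "del_coeff \<alpha> as i = of_bool ({as ! i, (as @ [E1]) ! Suc i} = {Ez, \<alpha>}) - of_bool ({(E0 # as) ! i, as ! i} = {Ez, \<alpha>})"

lemma del_word_eq:
  "del_word Ez \<alpha> as = (\<Sum>i<length as. of_int (del_coeff \<alpha> as i) * word_mon (take i as @ drop (Suc i) as))"
proof -
  have "del_word Ez \<alpha> as = (\<Sum>i\<in>Suc ` {..<length as}.
       of_int (of_bool ({(E0 # as @ [E1]) ! i, (E0 # as @ [E1]) ! (i + 1)} = {Ez, \<alpha>})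
             - of_bool ({(E0 # as @ [E1]) ! (i - 1), (E0 # as @ [E1]) ! i} = {Ez, \<alpha>}))
         * word_mon (take (i - 1) as @ drop i as))"
    unfolding del_word_def Let_def by (simp add: image_Suc_lessThan)
  also have "\<dots> = (\<Sum>i<length as. of_int (del_coeff \<alpha> as i) * word_mon (take i as @ drop (Suc i) as))"
    unfolding sum.reindex[OF inj_Suc] o_def
  proof (rule sum.cong)
    fix i assume i: "i \<in> {..<length as}"
    then have "(as @ [E1]) ! i = as ! i" "(E0 # as @ [E1]) ! i = (E0 # as) ! i"
      by (auto simp: nth_append nth_Cons split: nat.splits)
    then show "of_int (of_bool ({(E0 # as @ [E1]) ! Suc i, (E0 # as @ [E1]) ! (Suc i + 1)} = {Ez, \<alpha>})
             - of_bool ({(E0 # as @ [E1]) ! (Suc i - 1), (E0 # as @ [E1]) ! Suc i} = {Ez, \<alpha>}))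
         * word_mon (take (Suc i - 1) as @ drop (Suc i) as)
       = of_int (del_coeff \<alpha> as i) * word_mon (take i as @ drop (Suc i) as)"
      by (simp add: del_coeff_def)
  qed simp
  finally show ?thesis .
qed

text \<open>A deletion spoils admissibility only if the first letter is followed by
  \<open>E0\<close> or the last one is preceded by \<open>E1\<close>. The deleted letter then has
  equal neighbours on both sides, a boundary letter being one of them, so the two indicators cancel.
  Hence the operators preserve admissibility.\<close>

lemma del_coeff_inadmissible:
  assumes "admissible as" "i < length as" "\<not> admissible (take i as @ drop (Suc i) as)" "\<alpha> \<in> {E0, E1}"
  shows "del_coeff \<alpha> as i = 0"
proof -
  let ?v = "take i as @ drop (Suc i) as"
  have v: "?v \<noteq> []" "hd ?v = E0 \<or> last ?v = E1" using assms(3) by (auto simp: admissible_def)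
  have as: "as \<noteq> []" "hd as \<noteq> E0" "last as \<noteq> E1" using assms by (auto simp: admissible_def)
  from v(2) show ?thesis
  proof
    assume hd: "hd ?v = E0"
    have "i = 0"
    proof (rule ccontr)
      assume "i \<noteq> 0"
      then have "hd ?v = hd as" using as by (cases as; cases i) auto
      with hd as show False by simp
    qed
    with v hd have "as ! 1 = E0" "1 < length as" by (auto simp: hd_drop_conv_nth)
    then show ?thesis using \<open>i = 0\<close> by (simp add: del_coeff_def nth_append insert_commute)
  next
    assume last: "last ?v = E1"
    have i: "Suc i = length as"
    proof (rule ccontr)
      assume "Suc i \<noteq> length as"
      then have "drop (Suc i) as \<noteq> []" using assms(2) by simp
      then have "last ?v = last as" by simp
      with last as show False by simp
    qed
    then have "take i as \<noteq> []" "last (take i as) = E1" using v last by auto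
    then obtain j where j: "i = Suc j" "as ! j = E1"
      using assms(2) by (cases i) (auto simp: last_conv_nth)
    then show ?thesis using i by (simp add: del_coeff_def nth_append insert_commute)
  qed
qed

lemma keys_del:
  assumes "\<And>u. u \<in> Poly_Mapping.keys w \<Longrightarrow> admissible (letters u) \<and> length (letters u) < Suc n"
    and "\<alpha> \<in> {E0, E1}" and "v \<in> Poly_Mapping.keys (del Ez \<alpha> w)"
  shows "admissible (letters v) \<and> length (letters v) < n"
proof -
  obtain u where u: "u \<in> Poly_Mapping.keys w" "v \<in> Poly_Mapping.keys (del_word Ez \<alpha> (letters u))"
    using assms(3) keys_lin_ext unfolding del_def by blast
  define as where "as = letters u"
  have as: "admissible as" "length as < Suc n" using assms(1)[OF u(1)] by (auto simp: as_def)
  obtain i where i: "i < length as"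
    "v \<in> Poly_Mapping.keys (of_int (del_coeff \<alpha> as i) * word_mon (take i as @ drop (Suc i) as))"
    using subsetD[OF keys_sum u(2)[unfolded del_word_eq as_def[symmetric]]] by blast
  then have "del_coeff \<alpha> as i \<noteq> 0" by (intro notI) simp
  then have "admissible (take i as @ drop (Suc i) as)"
    using del_coeff_inadmissible[OF as(1) i(1)] assms(2) by blast
  moreover have "v = Word (take i as @ drop (Suc i) as)"
    using subsetD[OF keys_of_int_mult i(2)] by (simp add: word_mon_def)
  ultimately show ?thesis using as i(1) by auto
qed

text \<open>\<open>inner_del\<close> as an explicit sum, with the letters in their original order.
  The conditional omits the pair formed by the last letter and the upper end point.\<close>

definition del_sum :: "complex \<Rightarrow> letter list \<Rightarrow> (letter list \<Rightarrow> complex) \<Rightarrow> complex" where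
  "del_sum z as f = (\<Sum>i<length as. ((if Suc i < length as then dlog z (as ! i) (as ! Suc i) else 0)
      - dlog z ((E0 # as) ! i) (as ! i)) * f (take i as @ drop (Suc i) as))"

text \<open>Appending \<open>a\<close> changes only the coefficient of the former last letter and
  adds the term that deletes \<open>a\<close> itself. This is the recursion of
  \<open>inner_del\<close>, read from the other end.\<close>

lemma del_sum_snoc:
  assumes "as \<noteq> []"
  shows "del_sum z (as @ [a]) f = del_sum z as (\<lambda>v. f (v @ [a]))
           + dlog z (last as) a * (f (butlast as @ [a]) - f as)"
proof -
  obtain n where n: "length as = Suc n" using assms by (cases as) auto
  have l: "as ! n = last as" using n assms by (simp add: last_conv_nth)
  have t: "take n as = butlast as" using n by (simp add: butlast_conv_take)
  define g where "g as f i = ((if Suc i < length as then dlog z (as ! i) (as ! Suc i) else 0)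
      - dlog z ((E0 # as) ! i) (as ! i)) * f (take i as @ drop (Suc i) as)" 
    for as and f :: "letter list \<Rightarrow> complex" and i
  have ds: "del_sum z as f = (\<Sum>i<length as. g as f i)" for as f
    unfolding del_sum_def g_def ..
  have "g (as @ [a]) f i = g as (\<lambda>v. f (v @ [a])) i" if "i < n" for i
    using that n by (auto simp: g_def nth_append nth_Cons split: nat.splits)
  moreover have "g (as @ [a]) f n = g as (\<lambda>v. f (v @ [a])) n + dlog z (last as) a * f (butlast as @ [a])"
    using n l t by (auto simp: g_def nth_append nth_Cons algebra_simps split: nat.splits)
  moreover have "g (as @ [a]) f (Suc n) = - dlog z (last as) a * f as"
    using n l by (auto simp: g_def nth_append)
  ultimately show ?thesis
    unfolding ds by (simp add: n algebra_simps)
qed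

lemma inner_del_eq_del_sum: "inner_del z u f = del_sum z (rev u) (\<lambda>v. f (rev v))"
proof (induction z u f rule: inner_del.induct)
  case (3 z a b u f)
  have "del_sum z (rev (a # b # u)) (\<lambda>v. f (rev v)) = del_sum z (rev (b # u) @ [a]) (\<lambda>v. f (rev v))"
    by simp
  also have "\<dots> = del_sum z (rev (b # u)) (\<lambda>v. f (a # rev v))
        + dlog z b a * (f (a # u) - f (b # u))"
    by (subst del_sum_snoc) (auto simp: butlast_append)
  finally show ?case using 3 by simp
qed (auto simp: del_sum_def)

text \<open>At x = 1 the upper end point acts as the letter \<open>E1\<close>, so the end point term
  of \<open>iint_dz\<close> supplies the pair missing in \<open>del_sum\<close>. Sorting the
  \<open>dlog\<close> coefficients by \<open>1 / z\<close> and \<open>1 / (z - 1)\<close> then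
  separates the two operators.\<close>

lemma iint_dz_eq_del:
  assumes f_def: "f = (\<lambda>v. iint z (rev v) 1)"
  shows "iint_dz z (rev as) 1 = 1 / z * lin_ext f (del_word Ez E0 as) + 1 / (z - 1) * lin_ext f (del_word Ez E1 as)"
proof -
  have c: "1 / z * of_int (del_coeff E0 as i) + 1 / (z - 1) * of_int (del_coeff E1 as i)
      = dlog z (as ! i) ((as @ [E1]) ! Suc i) - dlog z ((E0 # as) ! i) (as ! i)" for i
  proof -
    have "1 / z * (p - q) + 1 / (z - 1) * (r - s) = (p / z + r / (z - 1)) - (q / z + s / (z - 1))"
      for p q r s :: complex
      by (simp add: diff_divide_distrib)
    then show ?thesis unfolding del_coeff_def dlog_def of_int_diff of_int_of_bool .
  qed
  have "1 / z * lin_ext f (del_word Ez E0 as) + 1 / (z - 1) * lin_ext f (del_word Ez E1 as)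
     = (\<Sum>i<length as. (1 / z * of_int (del_coeff E0 as i) + 1 / (z - 1) * of_int (del_coeff E1 as i))
          * f (take i as @ drop (Suc i) as))"
    unfolding del_word_eq lin_ext_sum lin_ext_of_int_mult lin_ext_word_mon
    by (simp only: sum_distrib_left distrib_right sum.distrib mult.assoc)
  also have "\<dots> = (\<Sum>i<length as. (dlog z (as ! i) ((as @ [E1]) ! Suc i) - dlog z ((E0 # as) ! i) (as ! i))
          * f (take i as @ drop (Suc i) as))"
    unfolding c ..
  also have "\<dots> = iint_dz z (rev as) 1"
  proof (cases as rule: rev_cases)
    case Nil
    then show ?thesis by simp
  next
    case (snoc bs b)
    have "(\<Sum>i<length as. (dlog z (as ! i) ((as @ [E1]) ! Suc i) - dlog z ((E0 # as) ! i) (as ! i))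
          * f (take i as @ drop (Suc i) as)) = del_sum z as f + dlog z b E1 * f bs"
    proof -
      have "(\<Sum>i<length bs. (dlog z (as ! i) ((as @ [E1]) ! Suc i) - dlog z ((E0 # as) ! i) (as ! i))
          * f (take i as @ drop (Suc i) as)) =
        (\<Sum>i<length bs. ((if Suc i < length as then dlog z (as ! i) (as ! Suc i) else 0)
      - dlog z ((E0 # as) ! i) (as ! i)) * f (take i as @ drop (Suc i) as))"
        by (rule sum.cong) (auto simp: snoc nth_append)
      then show ?thesis
        unfolding del_sum_def by (simp add: snoc nth_append algebra_simps)
    qed
    also have "del_sum z as f = inner_del z (rev as) (\<lambda>v. iint z v 1)"
      by (simp add: inner_del_eq_del_sum f_def)
    also have "dlog z b E1 = of_bool (b = Ez) / (z - complex_of_real 1)"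
      by (cases b) auto
    finally show ?thesis by (simp add: snoc f_def del: iint.simps)
  qed
  finally show ?thesis ..
qed

section \<open>Decay at infinity and the final induction\<close>

lemma Const_eq_0_imp:
  assumes "Const w = 0" "u \<in> Poly_Mapping.keys w"
  shows "Ez \<in> set (letters u)"
proof (rule ccontr)
  assume "Ez \<notin> set (letters u)"
  then have s: "set (letters u) \<subseteq> {E0, E1}"
    using letter.exhaust by (intro subsetI) (metis insert_iff)
  have "Poly_Mapping.lookup (Const w) u = (\<Sum>v\<in>Poly_Mapping.keys w. Poly_Mapping.lookup w v *
     Poly_Mapping.lookup (if set (letters v) \<subseteq> {E0, E1} then word_mon (letters v) else 0) u)"
    by (simp add: Const_def lin_ext_def lookup_sum lookup_of_int_mult)
  \<comment> \<open>Distinct words are linearly independent, so only \<open>v = u\<close>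
    contributes to this coefficient.\<close>
  also have "\<dots> = (\<Sum>v\<in>Poly_Mapping.keys w. if v = u then Poly_Mapping.lookup w v else 0)"
    by (rule sum.cong) (use s in \<open>auto simp: word_mon_def lookup_single when_def\<close>)
  also have "\<dots> = Poly_Mapping.lookup w u" using assms(2) by simp
  finally show False using assms by (simp add: in_keys_iff)
qed

text \<open>For \<open>d\<close> at least 1 no letter weight exceeds 1, and a single
  \<open>Ez\<close> already yields the decay \<open>1 / d\<close>.\<close>

lemma word_wt_Ez_le:
  assumes "1 \<le> d"
  shows "word_wt d u \<le> 2 ^ length u" "Ez \<in> set u \<Longrightarrow> word_wt d u \<le> 2 ^ length u / d"
proof -
  have pos: "0 < word_wt d v" for v using assms by (intro word_wt_pos) simp
  have l: "letter_wt d a \<le> 1" for a using assms by (simp add: letter_wt_def)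
  show 1: "word_wt d u \<le> 2 ^ length u" for u
  proof (induction u)
    case (Cons a u)
    have "letter_wt d a * word_wt d u \<le> 1 * 2 ^ length u"
      using l[of a] Cons pos[of u] by (intro mult_mono) auto
    then show ?case by simp
  qed simp
  show "Ez \<in> set u \<Longrightarrow> word_wt d u \<le> 2 ^ length u / d"
  proof (induction u)
    case (Cons a u)
    show ?case
    proof (cases "a = Ez")
      case True
      then show ?thesis using 1[of u] assms by (simp add: letter_wt_def divide_right_mono)
    next
      case False
      then show ?thesis using Cons by (simp add: letter_wt_def)
    qed
  qed simp
qed

text \<open>The hypotheses are those features of a standard relation that pass from \<open>w\<close>
  to \<open>del Ez \<alpha> w\<close>, with the length bound lowered by one. The induction
  hypothesis therefore kills both terms of the derivative.\<close>

lemma lin_ext_iint_vanishes: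
  assumes "\<And>u. u \<in> Poly_Mapping.keys w \<Longrightarrow> admissible (letters u) \<and> length (letters u) < n"
    and "\<And>\<alpha>s. set \<alpha>s \<subseteq> {E0, E1} \<Longrightarrow> Const (foldr (del Ez) \<alpha>s w) = 0"
    and "z \<notin> complex_of_real ` {0..1}"
  shows "lin_ext (\<lambda>v. iint z (rev v) 1) w = 0"
  using assms
proof (induction n arbitrary: w z)
  case 0
  then have "Poly_Mapping.keys w = {}" by blast
  then show ?case by (simp add: lin_ext_def)
next
  case (Suc n)
  define G where "G = (\<lambda>z. lin_ext (\<lambda>v. iint z (rev v) 1) w)"
  define S where "S = - (complex_of_real ` {0..1})"
  have del0: "lin_ext (\<lambda>v. iint z (rev v) 1) (del Ez \<alpha> w) = 0" if "\<alpha> \<in> {E0, E1}" "z \<in> S" for z \<alpha>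
  proof (rule Suc.IH)
    show "admissible (letters u) \<and> length (letters u) < n" if "u \<in> Poly_Mapping.keys (del Ez \<alpha> w)" for u
      using keys_del[OF Suc.prems(1) \<open>\<alpha> \<in> {E0, E1}\<close> that] by blast
    show "Const (foldr (del Ez) \<alpha>s (del Ez \<alpha> w)) = 0" if "set \<alpha>s \<subseteq> {E0, E1}" for \<alpha>s
      \<comment> \<open>In \<open>foldr\<close> the appended \<open>\<alpha>\<close> is the
        innermost operator, the one applied to \<open>w\<close> first.\<close>
      using Suc.prems(2)[of "\<alpha>s @ [\<alpha>]"] that \<open>\<alpha> \<in> {E0, E1}\<close> by simp
  qed (use that in \<open>auto simp: S_def\<close>)
  have deriv: "(G has_field_derivative 0) (at z)" if z: "z \<in> S" for z
  proof -
    obtain d where d: "far d z" using far_exists z by (auto simp: S_def)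
    define f where "f = (\<lambda>v. iint z (rev v) 1)"
    have "(G has_field_derivative (\<Sum>u\<in>Poly_Mapping.keys w. of_int (Poly_Mapping.lookup w u) * iint_dz z (rev (letters u)) 1)) (at z)"
      unfolding G_def lin_ext_def
    proof (intro DERIV_sum DERIV_cmult)
      fix u assume "u \<in> Poly_Mapping.keys w"
      then show "((\<lambda>z. iint z (rev (letters u)) 1) has_field_derivative iint_dz z (rev (letters u)) 1) (at z)"
        using Suc.prems(1)[of u]
        by (intro iint_has_field_derivative[OF d]) (auto simp: admissible_def hd_rev last_rev)
    qed
    also have "(\<Sum>u\<in>Poly_Mapping.keys w. of_int (Poly_Mapping.lookup w u) * iint_dz z (rev (letters u)) 1)
       = 1 / z * lin_ext (\<lambda>as. lin_ext f (del_word Ez E0 as)) w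
         + 1 / (z - 1) * lin_ext (\<lambda>as. lin_ext f (del_word Ez E1 as)) w"
      unfolding iint_dz_eq_del[OF f_def]
      by (simp add: lin_ext_def[of _ w] sum_distrib_left distrib_left sum.distrib algebra_simps)
    also have "\<dots> = 1 / z * lin_ext f (del Ez E0 w) + 1 / (z - 1) * lin_ext f (del Ez E1 w)"
      by (simp only: del_def lin_ext_lin_ext)
    also have "\<dots> = 0" using del0[OF _ z] by (simp add: f_def)
    finally show ?thesis .
  qed
  have "open S" unfolding S_def
    by (intro open_Compl compact_imp_closed compact_continuous_image continuous_intros) auto
  \<comment> \<open>As a segment the interval is bounded and convex, so its complement in the plane
    is connected.\<close>
  have seg: "complex_of_real ` {0..1} = closed_segment 0 1"
    by (auto simp: closed_segment_def image_iff scaleR_conv_of_real)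
  have "connected S" unfolding S_def seg
    by (rule connected_complement_bounded_convex) (auto intro: compact_imp_bounded)
  obtain c where c: "\<And>z. z \<in> S \<Longrightarrow> G z = c"
  proof (rule DERIV_zero_connected_constant[OF \<open>connected S\<close> \<open>open S\<close>, of "{}" G])
    show "continuous_on S G"
      using deriv by (intro continuous_at_imp_continuous_on) (auto intro: DERIV_isCont)
  qed (use deriv in auto)
  define K where "K = (\<Sum>u\<in>Poly_Mapping.keys w. \<bar>real_of_int (Poly_Mapping.lookup w u)\<bar> * 2 ^ length (letters u))"
  \<comment> \<open>Evaluating the constant at z = 1 + d, which has distance \<open>d\<close> from
    the interval, bounds it by \<open>K / d\<close> for every such \<open>d\<close>.\<close>
  have Kc: "norm c * d \<le> K" if d: "1 \<le> d" for d
  proof -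
    define z where "z = complex_of_real (1 + d)"
    have z: "far d z" using d by (intro far_large) (auto simp: z_def simp del: of_real_add)
    then have "z \<in> S" using far_neq[OF z] by (force simp: S_def)
    have "norm (G z) \<le> (\<Sum>u\<in>Poly_Mapping.keys w. norm (of_int (Poly_Mapping.lookup w u) * iint z (rev (letters u)) 1))"
      unfolding G_def lin_ext_def by (rule norm_sum)
    also have "\<dots> \<le> (\<Sum>u\<in>Poly_Mapping.keys w. \<bar>real_of_int (Poly_Mapping.lookup w u)\<bar> * (2 ^ length (letters u) / d))"
    proof (rule sum_mono)
      fix u assume u: "u \<in> Poly_Mapping.keys w"
      \<comment> \<open>The empty list of operators gives \<open>Const w = 0\<close>, so every word
        of \<open>w\<close> contains \<open>Ez\<close>.\<close>
      have "Ez \<in> set (letters u)" using Const_eq_0_imp[OF _ u] Suc.prems(2)[of "[]"] by simp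
      have "norm (iint z (rev (letters u)) 1) \<le> word_wt d (rev (letters u))"
        using Suc.prems(1)[OF u] by (intro iint_bound_1[OF z]) (auto simp: admissible_def hd_rev)
      also have "\<dots> \<le> 2 ^ length (letters u) / d"
        using word_wt_Ez_le(2)[OF d, of "rev (letters u)"] \<open>Ez \<in> set (letters u)\<close> by simp
      finally show "norm (of_int (Poly_Mapping.lookup w u) * iint z (rev (letters u)) 1)
          \<le> \<bar>real_of_int (Poly_Mapping.lookup w u)\<bar> * (2 ^ length (letters u) / d)"
        unfolding norm_mult norm_of_int by (intro mult_left_mono) auto
    qed
    also have "\<dots> = K / d" by (simp add: K_def sum_divide_distrib)
    finally show ?thesis using c[OF \<open>z \<in> S\<close>] d by (simp add: field_simps)
  qed
  have "c = 0"
  proof (rule ccontr)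
    assume "c \<noteq> 0"
    \<comment> \<open>This choice of \<open>d\<close> makes the left side of \<open>Kc\<close>
      exceed \<open>K\<close>.\<close>
    then have "norm c * max 1 ((K + 1) / norm c) \<ge> K + 1"
      by (simp add: max_def field_simps)
    with Kc[of "max 1 ((K + 1) / norm c)"] show False by simp
  qed
  then show ?case using c Suc.prems(3) by (simp add: G_def S_def)
qed

theorem theorem15:
  assumes "w \<in> I_ST"
  shows "\<forall>z \<in> UNIV - complex_of_real ` {0..1}. L z w = 0"
proof
  fix z assume "z \<in> UNIV - complex_of_real ` {0..1}"
  then have z: "z \<notin> complex_of_real ` {0..1}" by simp
  then obtain d where d: "far d z" by (rule far_exists)
  have adm: "admissible (letters u)" if "u \<in> Poly_Mapping.keys w" for u
    using admissible_Az0[OF _ that] assms by (simp add: I_ST_def)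
  \<comment> \<open>Inserting 0 keeps \<open>Max\<close> meaningful for w = 0, whose support is
    empty.\<close>
  define n where "n = Suc (Max (insert 0 ((\<lambda>u. length (letters u)) ` Poly_Mapping.keys w)))"
  have len: "length (letters u) < n" if "u \<in> Poly_Mapping.keys w" for u
    using that by (simp add: n_def less_Suc_eq_le)
  have "L z w = lin_ext (\<lambda>v. iint z (rev v) 1) w"
    unfolding L_def lin_ext_def using adm L_word_eq_iint[OF d]
    by (intro sum.cong) (auto simp: admissible_def)
  also have "\<dots> = 0"
    by (rule lin_ext_iint_vanishes[OF _ _ z]) (use adm len assms in \<open>auto simp: I_ST_def\<close>)
  finally show "L z w = 0" .
qed

end
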